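(* Let $G$ be a $\sigma$-compact, locally compact, unimodular amenable group and suppose that $(F_N)_{N\ge 1}$ is a symmetric F{\o}lner sequence for $G$. Let $\pi:G\to\mathcal{B}(\mathcal{H})$ be a (strongly) continuous representation of $G$ by invertible operators on a complex Hilbert space $\mathcal{H}$. Suppose that there is a constant $C\ge1$ such that, for every $N\ge 1$, $$\frac{1}{|F_Ng|}\int_{F_Ng}\|\pi(h)x\|^2\,\mathrm{d}m(h)\le C^2\|x\|^2$$ for every $x\in\mathcal{H}$ and every $g\in G$, and $$\frac{1}{|F_N|}\int_{F_N}\|\pi(h)^{*}x\|^2\,\mathrm{d}m(h)\le C^2\|x\|^2$$ for every $x\in\mathcal{H}$. Then $\pi$ is unitarizable, and there exists an invertible $L\in\mathcal{B}(\mathcal{H})$ with $\|L^{-1}\|\,\|L\|\le C^2$ such that $L^{-1}\pi L$ is a unitary representation of $G$.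
   Context: $m$ denotes a right invariant Haar measure on $G$, and $|E|=m(E)$ for measurable $E\subset G$. For $A,B\subset G$ and $s\in G$: $A^{-1}=\{a^{-1}:a\in A\}$, $As=\{as:a\in A\}$, and $A\triangle B=(A\setminus B)\cup(B\setminus A)$. A symmetric F{\o}lner sequence is a sequence $(F_N)_{N\ge1}$ of compact subsets of $G$ with $0<|F_N|<\infty$, $F_N^{-1}=F_N$, and $$\lim_{N\to\infty}\frac{|F_Ns\,\triangle\,F_N|}{|F_N|}=0\quad\text{for every } s\in G.$$ $\mathcal{B}(\mathcal{H})$ is the algebra of bounded linear operators on $\mathcal{H}$. A continuous representation of $G$ is a map $\pi:G\to\mathcal{B}(\mathcal{H})$ with $\pi(1)=I$, $\pi(g_1g_2)=\pi(g_1)\pi(g_2)$ for all $g_1,g_2\in G$, continuous for the strong operator topology on $\mathcal{B}(\mathcal{H})$. It is a unitary representation if $\pi(g)^*\pi(g)=I=\pi(g)\pi(g)^*$ for all $g\in G$. $\pi$ is unitarizable if there is an invertible $L\in\mathcal{B}(\mathcal{H})$ such that $g\mapsto L^{-1}\pi(g)L$ (denoted $L^{-1}\pi L$) is a unitary representation. *)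

theory Defs
  imports "HOL-Analysis.Analysis"
begin

text \<open>
  Groups are written additively, as instances of the library class
  \<^class>\<open>topological_group_add\<close>. This class does not assume commutativity:
  \<open>g + h\<close>, \<open>0\<close> and \<open>- g\<close> stand for the product, the identity and the inverse.
  ``Locally compact group'' includes the Hausdorff axiom, which enters as the sort \<^class>\<open>t2_space\<close>.
\<close>

subsection \<open>Complex Hilbert spaces\<close>

text \<open>
  The library has real inner product spaces only. A complex inner product space is such a space
  with a complex scalar multiplication extending the real one and a sesquilinear form (linear in
  the first argument) whose real part is \<^const>\<open>inner\<close>. Hence \<open>norm x = sqrt (Re (cinner x x))\<close>,
  and positive definiteness of \<open>cinner\<close> is inherited from that of \<^const>\<open>inner\<close>.
\<close>

class complex_inner = real_inner +
  fixes scaleC :: "complex \<Rightarrow> 'a \<Rightarrow> 'a" (infixr \<open>*\<^sub>C\<close> 75)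
    and cinner :: "'a \<Rightarrow> 'a \<Rightarrow> complex"
  assumes scaleC_add_right: "a *\<^sub>C (x + y) = a *\<^sub>C x + a *\<^sub>C y"
    and scaleC_add_left: "(a + b) *\<^sub>C x = a *\<^sub>C x + b *\<^sub>C x"
    and scaleC_scaleC: "a *\<^sub>C (b *\<^sub>C x) = (a * b) *\<^sub>C x"
    and scaleC_of_real: "complex_of_real r *\<^sub>C x = r *\<^sub>R x"
    and cinner_commute: "cinner x y = cnj (cinner y x)"
    and cinner_add_left: "cinner (x + y) z = cinner x z + cinner y z"
    and cinner_scaleC_left: "cinner (a *\<^sub>C x) y = a * cinner x y"
    and inner_eq_Re_cinner: "inner x y = Re (cinner x y)"

class complex_hilbert_space = complex_inner + complete_space


subsection \<open>Bounded operators\<close>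

text \<open>
  The elements of the library type of bounded operators are only real-linear; \<open>bounded_ops\<close> is the
  algebra of the complex-linear ones. The norm of that type is the operator norm.
\<close>

definition bounded_ops :: "('h::complex_hilbert_space \<Rightarrow>\<^sub>L 'h) set" where
  "bounded_ops = {A. \<forall>c x. blinfun_apply A (c *\<^sub>C x) = c *\<^sub>C blinfun_apply A x}"

definition adjoint_op :: "('h::complex_hilbert_space \<Rightarrow>\<^sub>L 'h) \<Rightarrow> ('h \<Rightarrow>\<^sub>L 'h)" where
  "adjoint_op A = (THE B. B \<in> bounded_ops \<and>
     (\<forall>x y. cinner (blinfun_apply A x) y = cinner x (blinfun_apply B y)))"

definition is_inverse_op :: "('h::complex_hilbert_space \<Rightarrow>\<^sub>L 'h) \<Rightarrow> ('h \<Rightarrow>\<^sub>L 'h) \<Rightarrow> bool" where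
  "is_inverse_op A B \<longleftrightarrow> B \<in> bounded_ops \<and> A o\<^sub>L B = id_blinfun \<and> B o\<^sub>L A = id_blinfun"

definition invertible_op :: "('h::complex_hilbert_space \<Rightarrow>\<^sub>L 'h) \<Rightarrow> bool" where
  "invertible_op A \<longleftrightarrow> A \<in> bounded_ops \<and> (\<exists>B. is_inverse_op A B)"

definition inverse_op :: "('h::complex_hilbert_space \<Rightarrow>\<^sub>L 'h) \<Rightarrow> ('h \<Rightarrow>\<^sub>L 'h)" where
  "inverse_op A = (THE B. is_inverse_op A B)"


subsection \<open>Representations\<close>

definition continuous_representation ::
    "('g::topological_group_add \<Rightarrow> 'h::complex_hilbert_space \<Rightarrow>\<^sub>L 'h) \<Rightarrow> bool" where
  "continuous_representation \<pi> \<longleftrightarrow>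
     (\<forall>g. \<pi> g \<in> bounded_ops) \<and>
     \<pi> 0 = id_blinfun \<and>
     (\<forall>g h. \<pi> (g + h) = \<pi> g o\<^sub>L \<pi> h) \<and>
     continuous_map euclidean strong_operator_topology \<pi>"

definition unitary_representation ::
    "('g::topological_group_add \<Rightarrow> 'h::complex_hilbert_space \<Rightarrow>\<^sub>L 'h) \<Rightarrow> bool" where
  "unitary_representation \<pi> \<longleftrightarrow>
     continuous_representation \<pi> \<and>
     (\<forall>g. adjoint_op (\<pi> g) o\<^sub>L \<pi> g = id_blinfun \<and> \<pi> g o\<^sub>L adjoint_op (\<pi> g) = id_blinfun)"

definition conjugate_rep ::
    "('h::complex_hilbert_space \<Rightarrow>\<^sub>L 'h) \<Rightarrow> ('g \<Rightarrow> 'h \<Rightarrow>\<^sub>L 'h) \<Rightarrow> 'g \<Rightarrow> 'h \<Rightarrow>\<^sub>L 'h" where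
  "conjugate_rep L \<pi> = (\<lambda>g. inverse_op L o\<^sub>L \<pi> g o\<^sub>L L)"

definition unitarizable ::
    "('g::topological_group_add \<Rightarrow> 'h::complex_hilbert_space \<Rightarrow>\<^sub>L 'h) \<Rightarrow> bool" where
  "unitarizable \<pi> \<longleftrightarrow> (\<exists>L. invertible_op L \<and> unitary_representation (conjugate_rep L \<pi>))"


subsection \<open>Haar measure, unimodularity, amenability\<close>

abbreviation right_translate :: "'g::plus set \<Rightarrow> 'g \<Rightarrow> 'g set" where
  "right_translate A s \<equiv> (\<lambda>a. a + s) ` A"

text \<open>
  A right Haar measure is a nonzero right invariant Radon measure on the Borel sets. Regularity
  has to be required, since the group need not be second countable.
\<close>

definition right_haar_measure :: "'g::{topological_group_add,t2_space} measure \<Rightarrow> bool" where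
  "right_haar_measure m \<longleftrightarrow>
     sets m = sets borel \<and>
     emeasure m UNIV \<noteq> 0 \<and>
     (\<forall>K. compact K \<longrightarrow> emeasure m K < \<infinity>) \<and>
     (\<forall>E\<in>sets borel. emeasure m E = (INF U\<in>{U. open U \<and> E \<subseteq> U}. emeasure m U)) \<and>
     (\<forall>U. open U \<longrightarrow> emeasure m U = (SUP K\<in>{K. compact K \<and> K \<subseteq> U}. emeasure m K)) \<and>
     (\<forall>E\<in>sets borel. \<forall>s. emeasure m (right_translate E s) = emeasure m E)"

text \<open>
  The modular function is trivial iff a right Haar measure \<open>m\<close> is also left invariant; this does
  not depend on \<open>m\<close>, as right Haar measures are unique up to a positive factor.
\<close>

definition unimodular :: "'g::{topological_group_add,t2_space} measure \<Rightarrow> bool" where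
  "unimodular m \<longleftrightarrow> (\<forall>E\<in>sets borel. \<forall>s. emeasure m ((\<lambda>a. s + a) ` E) = emeasure m E)"

definition sigma_compact_space :: "'a::topological_space itself \<Rightarrow> bool" where
  "sigma_compact_space _ \<longleftrightarrow>
     (\<exists>K :: nat \<Rightarrow> 'a set. (\<forall>n. compact (K n)) \<and> (\<Union>n. K n) = UNIV)"

definition ess_bounded :: "'a measure \<Rightarrow> ('a \<Rightarrow> real) set" where
  "ess_bounded m = {f \<in> borel_measurable m. \<exists>B. AE x in m. \<bar>f x\<bar> \<le> B}"

text \<open>
  Amenability: a left invariant mean on \<open>L\<^sup>\<infinity>(G)\<close>. The mean is given on representatives; by
  linearity and positivity it takes the same value on functions that agree almost everywhere.
\<close>

definition amenable :: "'g::{topological_group_add,t2_space} measure \<Rightarrow> bool" where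
  "amenable m \<longleftrightarrow> (\<exists>M :: ('g \<Rightarrow> real) \<Rightarrow> real.
     (\<forall>f\<in>ess_bounded m. \<forall>g\<in>ess_bounded m. M (\<lambda>x. f x + g x) = M f + M g) \<and>
     (\<forall>c. \<forall>f\<in>ess_bounded m. M (\<lambda>x. c * f x) = c * M f) \<and>
     (\<forall>f\<in>ess_bounded m. (AE x in m. 0 \<le> f x) \<longrightarrow> 0 \<le> M f) \<and>
     M (\<lambda>x. 1) = 1 \<and>
     (\<forall>s. \<forall>f\<in>ess_bounded m. M (\<lambda>x. f (s + x)) = M f))"

text \<open>The sequence is indexed by \<open>N \<ge> 1\<close>; the value \<open>F 0\<close> is irrelevant.\<close>

definition symmetric_folner_sequence ::
    "'g::{topological_group_add,t2_space} measure \<Rightarrow> (nat \<Rightarrow> 'g set) \<Rightarrow> bool" where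
  "symmetric_folner_sequence m F \<longleftrightarrow>
     (\<forall>N\<ge>1. compact (F N) \<and> 0 < emeasure m (F N) \<and> emeasure m (F N) < \<infinity> \<and>
        uminus ` F N = F N) \<and>
     (\<forall>s. (\<lambda>N. measure m (sym_diff (right_translate (F N) s) (F N)) / measure m (F N))
        \<longlonglongrightarrow> 0)"

text \<open>
  The average is taken in the extended nonnegative reals, so that no integrability side condition
  is needed to give the integral its meaning.
\<close>

definition average :: "'a measure \<Rightarrow> 'a set \<Rightarrow> ('a \<Rightarrow> real) \<Rightarrow> ennreal" where
  "average m A f = (\<integral>\<^sup>+h\<in>A. ennreal (f h) \<partial>m) / emeasure m A"

end

theory Submission
  imports Defs
begin

text \<open>
  Averaging \<open>inner (\<pi> h x) (\<pi> h y)\<close> over \<open>F N\<close> gives uniformly bounded forms, which have a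
  cluster point \<open>b\<close> by Tychonoff's theorem. The hypothesis on all translates of \<open>F 1\<close> forces \<open>\<pi>\<close> to
  be uniformly bounded, so the Folner condition makes \<open>b\<close> invariant under \<open>\<pi>\<close>. It satisfies
  \<open>b x x \<le> C\<^sup>2 * (norm x)\<^sup>2\<close>. The lower bound \<open>(norm x)\<^sup>2 \<le> C\<^sup>2 * b x x\<close> comes from averaging
  \<open>(norm x)\<^sup>2 = inner (\<pi> h x) (adjoint_op (\<pi> (- h)) x)\<close>, where the symmetry of \<open>F N\<close> and the
  inversion invariance of the Haar measure turn \<open>- h\<close> into \<open>h\<close>. If \<open>S\<close> is the positive operator
  representing \<open>b\<close>, then \<open>L\<close> is the inverse of the square root \<open>R\<close> of \<open>S\<close>: both \<open>norm R\<close>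
  and \<open>norm L\<close> are at most \<open>C\<close>, and \<open>R o\<^sub>L \<pi> g o\<^sub>L L\<close> is isometric by invariance of \<open>b\<close>.
\<close>

subclass (in complex_hilbert_space) banach ..

section \<open>Operators on Hilbert spaces\<close>

text \<open>The representing vector is the minimiser of \<open>J\<close>: boundedness of
  \<open>f\<close> keeps \<open>J\<close> bounded below, the parallelogram law makes a minimising
  sequence Cauchy, and the first variation vanishes at its limit. Working with the real
  \<open>inner\<close> alone suffices later, since complex linearity can be recovered
  separately.\<close>

lemma Riesz_representation:
  fixes f :: "'a::{real_inner, complete_space} \<Rightarrow> real"
  assumes "bounded_linear f"
  obtains z where "\<And>x. f x = inner z x"
proof -
  interpret f: bounded_linear f by fact
  obtain K where K: "\<And>x. norm (f x) \<le> norm x * K"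
    using f.bounded by blast
  define J where "J x = inner x x - 2 * f x" for x
  have J_ge: "- (K\<^sup>2) \<le> J x" for x
  proof -
    have "0 \<le> (norm x - K)\<^sup>2" by simp
    moreover have "f x \<le> norm x * K" using K[of x] by simp
    ultimately show ?thesis
      by (simp add: J_def power2_norm_eq_inner[symmetric] power2_diff)
  qed
  define I where "I = Inf (range J)"
  have bdd: "bdd_below (range J)"
    using J_ge by (intro bdd_belowI2)
  have I_le: "I \<le> J x" for x
    unfolding I_def by (rule cInf_lower[OF _ bdd]) simp
  \<comment> \<open>The linear part of \<open>J\<close> cancels in the parallelogram law, and
    \<open>J\<close> at the midpoint is at least \<open>I\<close>.\<close>
  have par: "(norm (x - y))\<^sup>2 \<le> 2 * (J x - I) + 2 * (J y - I)" for x y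
  proof -
    have "4 * J ((1/2) *\<^sub>R (x + y)) + (norm (x - y))\<^sup>2 = 2 * J x + 2 * J y"
      by (simp add: J_def power2_norm_eq_inner f.scaleR f.add algebra_simps inner_commute)
    then show ?thesis using I_le[of "(1/2) *\<^sub>R (x + y)"] by simp
  qed
  have "\<exists>x. J x < I + 1 / Suc n" for n
    using cInf_less_iff[OF _ bdd, of "I + 1 / Suc n"] by (auto simp: I_def)
  then obtain X where X: "\<And>n. J (X n) < I + 1 / Suc n" by metis
  have J_lim: "(\<lambda>n. J (X n)) \<longlonglongrightarrow> I"
  proof (rule tendsto_sandwich[where f = "\<lambda>_. I" and h = "\<lambda>n. I + 1 / Suc n"])
    show "(\<lambda>n. I + 1 / Suc n) \<longlonglongrightarrow> I"
      using tendsto_add[OF tendsto_const LIMSEQ_inverse_real_of_nat, of I]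
      by (simp add: inverse_eq_divide)
    show "\<forall>\<^sub>F n in sequentially. J (X n) \<le> I + 1 / Suc n"
      using X by (intro always_eventually allI less_imp_le)
  qed (use I_le in \<open>auto intro!: always_eventually\<close>)
  have "Cauchy X"
  proof (rule CauchyI)
    fix e :: real assume "0 < e"
    then obtain N where N: "\<And>n. n \<ge> N \<Longrightarrow> J (X n) - I < e\<^sup>2 / 4"
      using LIMSEQ_D[OF J_lim, of "e\<^sup>2 / 4"] I_le by auto
    have "norm (X m - X n) < e" if "m \<ge> N" "n \<ge> N" for m n
    proof (rule power2_less_imp_less)
      show "(norm (X m - X n))\<^sup>2 < e\<^sup>2"
        using par[of "X m" "X n"] N[OF that(1)] N[OF that(2)] by simp
    qed (use \<open>0 < e\<close> in simp)
    then show "\<exists>M. \<forall>m\<ge>M. \<forall>n\<ge>M. norm (X m - X n) < e" by blast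
  qed
  then obtain z where z: "X \<longlonglongrightarrow> z"
    using Cauchy_convergent convergent_def by blast
  have "(\<lambda>n. J (X n)) \<longlonglongrightarrow> J z"
    unfolding J_def by (intro tendsto_intros z f.tendsto)
  then have Jz: "J z = I" using J_lim LIMSEQ_unique by blast
  have "f v = inner z v" for v
  proof -
    define d where "d = inner z v - f v"
    have "0 \<le> 2 * t * d + t\<^sup>2 * inner v v" for t
      using I_le[of "z + t *\<^sub>R v"] Jz
      by (simp add: J_def d_def f.add f.scaleR inner_add inner_commute algebra_simps power2_eq_square)
    \<comment> \<open>The quadratic in \<open>t\<close> is smallest at
      \<open>- d / inner v v\<close>; the added 1 avoids a division by zero and still gives a
      negative value unless \<open>d = 0\<close>.\<close>
    from this[of "- d / (inner v v + 1)"]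
    have "0 \<le> (2 * (- d / (inner v v + 1)) * d + (- d / (inner v v + 1))\<^sup>2 * inner v v) * (inner v v + 1)\<^sup>2"
      by (intro mult_nonneg_nonneg) auto
    also have "\<dots> = - (d\<^sup>2 * (inner v v + 2))"
    proof -
      define p where "p = inner v v + 1"
      have p: "inner v v = p - 1" and "p > 0"
        using inner_ge_zero[of v] by (auto simp: p_def simp del: inner_ge_zero)
      then show ?thesis
        unfolding p by (simp add: field_simps power2_eq_square)
    qed
    finally have "d\<^sup>2 * (inner v v + 2) \<le> 0" by simp
    then have "d\<^sup>2 \<le> 0"
      by (metis inner_ge_zero add_nonneg_pos linorder_not_less mult_pos_pos zero_less_numeral)
    then show ?thesis by (simp add: d_def)
  qed
  then show ?thesis using that by blast
qed

text \<open>Riesz representation in the second argument for each fixed \<open>x\<close>; testing the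
  form at \<open>y = s x\<close> bounds the resulting map.\<close>

lemma bounded_bilinear_imp_operator:
  fixes b :: "'a::{real_inner, complete_space} \<Rightarrow> 'a \<Rightarrow> real"
  assumes "bounded_bilinear b"
  obtains S :: "'a \<Rightarrow>\<^sub>L 'a" where "\<And>x y. b x y = inner (S x) y"
proof -
  interpret b: bounded_bilinear b by fact
  have "\<exists>z. \<forall>y. b x y = inner z y" for x
    using Riesz_representation[OF b.bounded_linear_right] by metis
  then obtain s where s: "\<And>x y. b x y = inner (s x) y" by metis
  obtain K where K: "K \<ge> 0" "\<And>x y. norm (b x y) \<le> norm x * norm y * K"
    using b.nonneg_bounded by blast
  have "bounded_linear s"
  proof (rule bounded_linear_intro[of _ K])
    show "s (x + y) = s x + s y" for x y
      by (rule vector_eq_rdot[THEN iffD1]) (auto simp: s[symmetric] b.add_left inner_add)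
    show "s (r *\<^sub>R x) = r *\<^sub>R s x" for r x
      by (rule vector_eq_rdot[THEN iffD1]) (auto simp: s[symmetric] b.scaleR_left)
    show "norm (s x) \<le> norm x * K" for x
    proof (cases "s x = 0")
      case False
      have "norm (s x) * norm (s x) = b x (s x)"
        by (simp add: s power2_norm_eq_inner[symmetric] power2_eq_square[symmetric])
      also have "\<dots> \<le> norm (s x) * (norm x * K)"
        using K(2)[of x "s x"] by (simp add: mult_ac)
      finally show ?thesis using False by simp
    qed (use K in simp)
  qed
  then show ?thesis
    using that[of "Blinfun s"] s by (simp add: bounded_linear_Blinfun_apply)
qed

section \<open>Square roots of positive operators\<close>

text \<open>By polarization, off-diagonal values of a symmetric form are controlled by its diagonal.
  This turns two-sided form bounds into the operator norm bound that the contraction argument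
  requires.\<close>

lemma self_adjoint_norm_le:
  fixes A :: "'a::real_inner \<Rightarrow>\<^sub>L 'a"
  assumes sym: "\<And>x y. inner (A x) y = inner x (A y)"
    and le: "\<And>x. \<bar>inner (A x) x\<bar> \<le> q * (norm x)\<^sup>2"
  shows "norm (A x) \<le> q * norm x"
proof (cases "A x = 0")
  case True
  have "0 \<le> q * (norm x)\<^sup>2" using le[of x] by linarith
  then show ?thesis
    using True by (cases "x = 0") (auto simp: zero_le_mult_iff)
next
  case False
  then have "x \<noteq> 0" by auto
  \<comment> \<open>The test vector points along \<open>A x\<close>, and its length equals that of
    \<open>x\<close>, so that the parallelogram law yields exactly
    \<open>4 * (norm x)\<^sup>2\<close>.\<close>
  define y where "y = (norm x / norm (A x)) *\<^sub>R A x"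
  have ny: "norm y = norm x" using False by (simp add: y_def)
  have "4 * inner (A x) y = inner (A (x + y)) (x + y) - inner (A (x - y)) (x - y)"
    using sym[of x y]
    by (simp add: blinfun.add_right blinfun.diff_right inner_add inner_diff inner_commute)
  also have "\<dots> \<le> q * ((norm (x + y))\<^sup>2 + (norm (x - y))\<^sup>2)"
    using le[of "x + y"] le[of "x - y"] by (simp add: algebra_simps)
  also have "\<dots> = q * (2 * (norm x)\<^sup>2 + 2 * (norm y)\<^sup>2)"
    by (simp add: power2_norm_eq_inner inner_add inner_diff inner_commute)
  finally have "inner (A x) y \<le> q * (norm x)\<^sup>2" by (simp add: ny)
  moreover have "inner (A x) y = norm x * norm (A x)"
    using False by (simp add: y_def power2_norm_eq_inner[symmetric] power2_eq_square)
  ultimately have "norm x * norm (A x) \<le> norm x * (q * norm x)"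
    by (simp add: power2_eq_square mult_ac)
  then show ?thesis using \<open>x \<noteq> 0\<close> by simp
qed

text \<open>
  The square root of \<open>1 - A\<close> is sought in the form \<open>1 - Y\<close>, which turns \<open>(1 - Y)\<^sup>2 = 1 - A\<close> into
  the fixed point equation \<open>Y = (A + Y\<^sup>2) / 2\<close> of a contraction of the ball of radius \<open>q\<close>.
\<close>

lemma sqrt_fixed_point:
  fixes A :: "'a::{real_inner, banach} \<Rightarrow>\<^sub>L 'a"
  assumes sym: "\<And>x y. inner (A x) y = inner x (A y)"
    and q: "norm A \<le> q" "q < 1"
  obtains Y :: "'a \<Rightarrow>\<^sub>L 'a" where "norm Y \<le> q" "A = 2 *\<^sub>R Y - (Y o\<^sub>L Y)"
    "\<And>x y. inner (Y x) y = inner x (Y y)"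
    "\<And>Z :: 'a \<Rightarrow>\<^sub>L 'a. A o\<^sub>L Z = Z o\<^sub>L A \<Longrightarrow> Y o\<^sub>L Z = Z o\<^sub>L Y"
proof -
  have q0: "0 \<le> q" using q norm_ge_zero[of A] by linarith
  \<comment> \<open>Symmetry and commutation with everything that commutes with \<open>A\<close> are
    closed conditions preserved by \<open>\<Phi>\<close>. Building them into the domain hands them
    to the fixed point.\<close>
  define D where "D = {Y :: 'a \<Rightarrow>\<^sub>L 'a. norm Y \<le> q \<and>
    (\<forall>x y. inner (blinfun_apply Y x) y = inner x (blinfun_apply Y y)) \<and>
    (\<forall>Z. A o\<^sub>L Z = Z o\<^sub>L A \<longrightarrow> (\<forall>x. blinfun_apply Y (Z x) = blinfun_apply Z (Y x)))}"
  define \<Phi> where "\<Phi> Y = (1/2) *\<^sub>R (A + (Y o\<^sub>L Y))" for Y :: "'a \<Rightarrow>\<^sub>L 'a"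
  have "closed D"
    unfolding D_def by (intro closed_Collect_conj closed_Collect_all closed_Collect_imp
      closed_Collect_le closed_Collect_eq continuous_intros) auto
  then have complete: "complete D" by (simp add: complete_eq_closed)
  have "0 \<in> D" using q0 by (simp add: D_def)
  have "\<Phi> Y \<in> D" if Y: "Y \<in> D" for Y
  proof -
    have "norm (A + (Y o\<^sub>L Y)) \<le> norm A + norm (Y o\<^sub>L Y)" by (rule norm_triangle_ineq)
    also have "norm (Y o\<^sub>L Y) \<le> norm Y * norm Y" by (rule norm_blinfun_compose)
    also have "norm Y * norm Y \<le> q * 1"
      using Y q q0 by (intro mult_mono) (auto simp: D_def)
    finally have "norm (\<Phi> Y) \<le> q" using q by (simp add: \<Phi>_def)
    moreover have "inner (\<Phi> Y x) y = inner x (\<Phi> Y y)" for x y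
      using Y sym by (simp add: D_def \<Phi>_def blinfun.scaleR_left blinfun.add_left inner_add)
    moreover have "\<Phi> Y (Z x) = Z (\<Phi> Y x)" if Z: "A o\<^sub>L Z = Z o\<^sub>L A" for Z x
    proof -
      have "A (Z x) = Z (A x)" using arg_cong[OF Z, of "\<lambda>f. blinfun_apply f x"] by simp
      then show ?thesis
        using Y Z by (simp add: D_def \<Phi>_def blinfun.bilinear_simps)
    qed
    ultimately show ?thesis by (simp add: D_def)
  qed
  then have into: "\<Phi> ` D \<subseteq> D" by blast
  have contr: "dist (\<Phi> Y) (\<Phi> Z) \<le> q * dist Y Z" if "Y \<in> D" "Z \<in> D" for Y Z
  proof -
    \<comment> \<open>This factorization of the difference of squares holds without commutativity of
      \<open>Y\<close> and \<open>Z\<close>.\<close>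
    have "\<Phi> Y - \<Phi> Z = (1/2) *\<^sub>R ((Y o\<^sub>L (Y - Z)) + ((Y - Z) o\<^sub>L Z))"
      by (rule blinfun_eqI) (simp add: \<Phi>_def blinfun.bilinear_simps algebra_simps)
    then have "norm (\<Phi> Y - \<Phi> Z) \<le> (norm (Y o\<^sub>L (Y - Z)) + norm ((Y - Z) o\<^sub>L Z)) / 2"
      by (simp add: norm_triangle_ineq)
    also have "\<dots> \<le> (norm Y * norm (Y - Z) + norm (Y - Z) * norm Z) / 2"
      by (intro divide_right_mono add_mono norm_blinfun_compose) auto
    also have "\<dots> \<le> (q * norm (Y - Z) + norm (Y - Z) * q) / 2"
      using that by (intro divide_right_mono add_mono mult_mono) (auto simp: D_def q0)
    finally show ?thesis by (simp add: dist_norm mult_ac)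
  qed
  have "D \<noteq> {}" using \<open>0 \<in> D\<close> by blast
  then have "\<exists>!Y\<in>D. \<Phi> Y = Y"
    by (rule Banach_fix[OF complete _ q0 \<open>q < 1\<close> into contr])
  then obtain Y where Y: "Y \<in> D" "\<Phi> Y = Y" by blast
  have "2 *\<^sub>R Y = A + (Y o\<^sub>L Y)"
    using arg_cong[OF Y(2), of "\<lambda>X. 2 *\<^sub>R X"] by (simp add: \<Phi>_def)
  then have "A = 2 *\<^sub>R Y - (Y o\<^sub>L Y)" by simp
  moreover have "Y o\<^sub>L Z = Z o\<^sub>L Y" if "A o\<^sub>L Z = Z o\<^sub>L A" for Z :: "'a \<Rightarrow>\<^sub>L 'a"
    using Y(1) that by (intro blinfun_eqI) (simp add: D_def)
  moreover have "norm Y \<le> q" "\<And>x y. inner (Y x) y = inner x (Y y)"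
    using Y(1) by (simp_all add: D_def)
  ultimately show ?thesis using that[of Y] by blast
qed

text \<open>Solving \<open>x - Y x = y\<close> means finding the fixed point of the contraction
  sending \<open>x\<close> to \<open>y + Y x\<close>; this takes the place of a Neumann
  series.\<close>

lemma bij_id_minus_operator:
  fixes Y :: "'a::banach \<Rightarrow>\<^sub>L 'a"
  assumes "norm Y < 1"
  shows "bij (\<lambda>x. x - Y x)"
proof -
  have "\<exists>!x. x - Y x = y" for y
  proof -
    have "\<exists>!x. y + Y x = x"
    proof (rule banach_fix_type[of "norm Y"])
      show "\<forall>x x'. dist (y + Y x) (y + Y x') \<le> norm Y * dist x x'"
        by (auto simp: dist_norm blinfun.diff_right[symmetric] norm_blinfun)
    qed (use assms in auto)
    moreover have "x - Y x = y \<longleftrightarrow> y + Y x = x" for x by (auto simp: algebra_simps)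
    ultimately show ?thesis by simp
  qed
  then show ?thesis unfolding bij_iff by blast
qed

text \<open>Write \<open>S\<close> as \<open>d\<close> times \<open>1 - A\<close>. The form bounds
  place the diagonal values of \<open>A\<close> between 0 and \<open>q < 1\<close>, so
  \<open>sqrt_fixed_point\<close> applies and \<open>R\<close> is \<open>sqrt d\<close> times
  \<open>1 - Y\<close>. The commutation clause later transfers complex linearity from
  \<open>S\<close> to \<open>R\<close>.\<close>

lemma positive_operator_sqrt:
  fixes S :: "'a::{real_inner, banach} \<Rightarrow>\<^sub>L 'a"
  assumes sym: "\<And>x y. inner (S x) y = inner x (S y)"
    and c: "0 < c" "\<And>x. c * (norm x)\<^sup>2 \<le> inner (S x) x"
    and d: "\<And>x. inner (S x) x \<le> d * (norm x)\<^sup>2" and "0 < d"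
  obtains R L :: "'a \<Rightarrow>\<^sub>L 'a" where "R o\<^sub>L L = id_blinfun" "L o\<^sub>L R = id_blinfun"
    "\<And>x. (norm (R x))\<^sup>2 = inner (S x) x"
    "\<And>Z :: 'a \<Rightarrow>\<^sub>L 'a. S o\<^sub>L Z = Z o\<^sub>L S \<Longrightarrow> R o\<^sub>L Z = Z o\<^sub>L R"
proof -
  define A where "A = id_blinfun - (1/d) *\<^sub>R S"
  \<comment> \<open>The bounds force \<open>c \<le> d\<close> except on the zero space;
    \<open>max 0\<close> guards that case.\<close>
  define q where "q = max 0 (1 - c / d)"
  have q: "0 \<le> q" "q < 1" using \<open>0 < c\<close> \<open>0 < d\<close> by (auto simp: q_def)
  have A: "A x = x - (1/d) *\<^sub>R S x" for x
    by (simp add: A_def blinfun.bilinear_simps)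
  have symA: "inner (A x) y = inner x (A y)" for x y
    using sym by (simp add: A inner_diff)
  have "\<bar>inner (A x) x\<bar> \<le> q * (norm x)\<^sup>2" for x
  proof -
    have "inner (A x) x = (norm x)\<^sup>2 - inner (S x) x / d"
      by (simp add: A inner_diff power2_norm_eq_inner)
    moreover have "c / d * (norm x)\<^sup>2 \<le> inner (S x) x / d" "inner (S x) x / d \<le> (norm x)\<^sup>2"
      using c(2)[of x] d[of x] \<open>0 < d\<close> by (simp_all add: field_simps)
    moreover have "(1 - c / d) * (norm x)\<^sup>2 \<le> q * (norm x)\<^sup>2"
      by (intro mult_right_mono) (auto simp: q_def)
    ultimately show ?thesis by (simp add: algebra_simps)
  qed
  then have "norm (A x) \<le> q * norm x" for x
    by (rule self_adjoint_norm_le[OF symA])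
  then have "norm A \<le> q" using q by (intro norm_blinfun_bound) auto
  from sqrt_fixed_point[OF symA this \<open>q < 1\<close>] obtain Y where Y: "norm Y \<le> q"
    "A = 2 *\<^sub>R Y - (Y o\<^sub>L Y)" "\<And>x y. inner (Y x) y = inner x (Y y)"
    "\<And>Z :: 'a \<Rightarrow>\<^sub>L 'a. A o\<^sub>L Z = Z o\<^sub>L A \<Longrightarrow> Y o\<^sub>L Z = Z o\<^sub>L Y" by blast
  define R where "R = sqrt d *\<^sub>R (id_blinfun - Y)"
  have R: "R x = sqrt d *\<^sub>R (x - Y x)" for x
    by (simp add: R_def blinfun.bilinear_simps)
  have normR: "(norm (R x))\<^sup>2 = inner (S x) x" for x
  proof -
    \<comment> \<open>Symmetry of \<open>Y\<close> moves one factor \<open>1 - Y\<close> across, and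
      the square of \<open>1 - Y\<close> is \<open>1 - A\<close>.\<close>
    have "(norm (R x))\<^sup>2 = d * (inner x x - inner (2 *\<^sub>R Y x - Y (Y x)) x)"
      using \<open>0 < d\<close> Y(3)[of "Y x" x]
      by (simp add: R power_mult_distrib power2_norm_eq_inner inner_diff inner_commute)
    also have "2 *\<^sub>R Y x - Y (Y x) = A x"
      by (simp only: Y(2) minus_blinfun.rep_eq scaleR_blinfun.rep_eq blinfun_apply_blinfun_compose)
    finally show ?thesis using \<open>0 < d\<close> by (simp add: A inner_diff)
  qed
  have "bij (\<lambda>x :: 'a. sqrt d *\<^sub>R x)"
    using \<open>0 < d\<close> by (intro bij_betw_byWitness[where f' = "\<lambda>x. (1 / sqrt d) *\<^sub>R x"]) auto
  then have "bij (\<lambda>x. sqrt d *\<^sub>R (x - Y x))"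
    using bij_comp[OF bij_id_minus_operator[of Y]] Y(1) q by (auto simp: o_def)
  then have bij: "bij R" by (simp add: R[abs_def, symmetric])
  have "bounded_linear (inv R)"
  \<comment> \<open>The constant comes from the lower bound of \<open>S\<close> evaluated at
    \<open>inv R x\<close>, where \<open>norm (R (inv R x))\<close> is
    \<open>norm x\<close>.\<close>
  proof (rule bounded_linear_intro[of _ "1 / sqrt c"])
    have RR: "R (inv R x) = x" for x using bij by (simp add: bij_is_surj surj_f_inv_f)
    have "inv R (R x) = x" for x using bij by (simp add: bij_is_inj)
    from this[of "inv R x + inv R y" for x y] this[of "r *\<^sub>R inv R x" for r x]
    show "inv R (x + y) = inv R x + inv R y" "inv R (r *\<^sub>R x) = r *\<^sub>R inv R x" for r x y
      by (simp_all add: blinfun.bilinear_simps RR)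
    show "norm (inv R x) \<le> norm x * (1 / sqrt c)" for x
    proof -
      have "c * (norm (inv R x))\<^sup>2 \<le> (norm x)\<^sup>2"
        using c(2)[of "inv R x"] normR[of "inv R x"] by (simp add: RR)
      then have "sqrt (c * (norm (inv R x))\<^sup>2) \<le> sqrt ((norm x)\<^sup>2)"
        by (rule real_sqrt_le_mono)
      then show ?thesis using \<open>0 < c\<close> by (simp add: real_sqrt_mult field_simps)
    qed
  qed
  then have L: "blinfun_apply (Blinfun (inv R)) = inv R" by (rule bounded_linear_Blinfun_apply)
  show ?thesis
  proof (rule that[of R "Blinfun (inv R)"])
    show "R o\<^sub>L Blinfun (inv R) = id_blinfun" "Blinfun (inv R) o\<^sub>L R = id_blinfun"
      using bij by (auto intro!: blinfun_eqI simp: L bij_is_inj bij_is_surj surj_f_inv_f)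
    fix Z :: "'a \<Rightarrow>\<^sub>L 'a"
    assume Z: "S o\<^sub>L Z = Z o\<^sub>L S"
    have SZ: "S (Z x) = Z (S x)" for x using arg_cong[OF Z, of "\<lambda>f. blinfun_apply f x"] by simp
    have "A o\<^sub>L Z = Z o\<^sub>L A"
      by (rule blinfun_eqI) (simp add: A SZ blinfun.bilinear_simps)
    then have "Y o\<^sub>L Z = Z o\<^sub>L Y" by (rule Y(4))
    from arg_cong[OF this, of "\<lambda>f. blinfun_apply f x" for x]
    show "R o\<^sub>L Z = Z o\<^sub>L R"
      by (intro blinfun_eqI) (simp add: R blinfun.bilinear_simps)
  qed (rule normR)
qed

section \<open>Complex structure, adjoints and unitarity through the real inner product\<close>

lemma Im_cinner: "Im (cinner x y) = inner x (\<i> *\<^sub>C y)"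
  using cinner_commute[of x "\<i> *\<^sub>C y"] cinner_commute[of x y]
  by (simp add: inner_eq_Re_cinner cinner_scaleC_left)

lemma cinner_eq_iff: "cinner x y = cinner x' y' \<longleftrightarrow>
    inner x y = inner x' y' \<and> inner x (\<i> *\<^sub>C y) = inner x' (\<i> *\<^sub>C y')"
  by (simp add: complex_eq_iff Im_cinner inner_eq_Re_cinner)

lemma inner_scaleC_left: "inner (c *\<^sub>C x) y = inner x (cnj c *\<^sub>C y)"
  using cinner_commute[of x "cnj c *\<^sub>C y"] cinner_commute[of x y]
  by (simp add: inner_eq_Re_cinner cinner_scaleC_left)

lemma norm_scaleC: "norm (c *\<^sub>C x) = cmod c * norm x"
proof (rule power2_eq_imp_eq)
  have "inner (c *\<^sub>C x) (c *\<^sub>C x) = inner (complex_of_real ((cmod c)\<^sup>2) *\<^sub>C x) x"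
    by (subst inner_scaleC_left)
      (metis complex_norm_square inner_commute mult.commute scaleC_scaleC)
  then show "(norm (c *\<^sub>C x))\<^sup>2 = (cmod c * norm x)\<^sup>2"
    by (simp add: power2_norm_eq_inner scaleC_of_real power_mult_distrib del: of_real_power)
qed simp_all

lemma bounded_linear_scaleC: "bounded_linear (\<lambda>x :: 'a::complex_inner. c *\<^sub>C x)"
proof (rule bounded_linear_intro[of _ "cmod c"])
  show "c *\<^sub>C (r *\<^sub>R x) = r *\<^sub>R (c *\<^sub>C x)" for r and x :: 'a
    by (simp add: scaleC_of_real[symmetric] scaleC_scaleC mult.commute)
qed (simp_all add: scaleC_add_right norm_scaleC)

text \<open>Phrasing complex linearity as commutation with the scalar operators makes it accessible
  to the commutation clause of \<open>positive_operator_sqrt\<close>.\<close>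

lemma bounded_ops_iff_commute:
  fixes A :: "'h::complex_hilbert_space \<Rightarrow>\<^sub>L 'h"
  shows
  "A \<in> bounded_ops \<longleftrightarrow> (\<forall>c. A o\<^sub>L Blinfun (\<lambda>x. c *\<^sub>C x) = Blinfun (\<lambda>x. c *\<^sub>C x) o\<^sub>L A)"
  unfolding bounded_ops_def blinfun_apply_inject[symmetric] fun_eq_iff
  by (simp add: bounded_linear_Blinfun_apply[OF bounded_linear_scaleC])

lemma bounded_ops_compose: "A \<in> bounded_ops \<Longrightarrow> B \<in> bounded_ops \<Longrightarrow> A o\<^sub>L B \<in> bounded_ops"
  by (simp add: bounded_ops_def)

lemma bounded_opsI_form:
  fixes A :: "'h::complex_hilbert_space \<Rightarrow>\<^sub>L 'h"
  assumes "\<And>c x y. inner (A (c *\<^sub>C x)) y = inner (A x) (cnj c *\<^sub>C y)"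
  shows "A \<in> bounded_ops"
  unfolding bounded_ops_def
proof safe
  fix c x
  show "A (c *\<^sub>C x) = c *\<^sub>C A x"
    by (rule vector_eq_rdot[THEN iffD1]) (simp add: assms inner_scaleC_left)
qed

text \<open>The real identity determines the adjoint: complex linearity of \<open>B\<close> supplies
  the imaginary part, obtained by pairing with \<open>\<i> *\<^sub>C y\<close>.\<close>

lemma adjoint_op_eqI:
  fixes A B :: "'h::complex_hilbert_space \<Rightarrow>\<^sub>L 'h"
  assumes B: "B \<in> bounded_ops" and AB: "\<And>x y. inner (A x) y = inner x (B y)"
  shows "adjoint_op A = B"
  unfolding adjoint_op_def
proof (rule the_equality)
  have "B (c *\<^sub>C x) = c *\<^sub>C B x" for c x using B by (simp add: bounded_ops_def)
  then show "B \<in> bounded_ops \<and> (\<forall>x y. cinner (A x) y = cinner x (B y))"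
    using B by (simp add: cinner_eq_iff AB)
next
  fix B' assume "B' \<in> bounded_ops \<and> (\<forall>x y. cinner (A x) y = cinner x (B' y))"
  then have "\<forall>x y. inner x (B y) = inner x (B' y)"
    by (metis AB inner_eq_Re_cinner)
  then show "B' = B" by (metis blinfun_eqI vector_eq_ldot)
qed

text \<open>Existence of the adjoint: represent the flipped form \<open>inner (A v) u\<close> by an
  operator, and deduce its complex linearity from that of \<open>A\<close>.\<close>

lemma inner_adjoint_op:
  fixes A :: "'h::complex_hilbert_space \<Rightarrow>\<^sub>L 'h"
  assumes "A \<in> bounded_ops"
  shows "inner (A x) y = inner x (adjoint_op A y)"
proof -
  have "bounded_bilinear (\<lambda>u v. inner (A v) u)"
    using bounded_bilinear.flip[OF bounded_bilinear.comp1[OF bounded_bilinear_inner blinfun.bounded_linear_right]] .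
  then obtain B :: "'h \<Rightarrow>\<^sub>L 'h" where B: "\<And>u v. inner (A v) u = inner (B u) v"
    using bounded_bilinear_imp_operator by blast
  have "B \<in> bounded_ops"
  proof (rule bounded_opsI_form)
    fix c and x y :: 'h
    have "A (cnj c *\<^sub>C y) = cnj c *\<^sub>C A y" using assms by (simp add: bounded_ops_def)
    then show "inner (B (c *\<^sub>C x)) y = inner (B x) (cnj c *\<^sub>C y)"
      by (simp add: B[symmetric] inner_scaleC_left)
  qed
  then have "adjoint_op A = B"
    by (rule adjoint_op_eqI) (metis B inner_commute)
  then show ?thesis by (metis B inner_commute)
qed

lemma inverse_op_eqI:
  assumes "is_inverse_op A B"
  shows "inverse_op A = B"
  unfolding inverse_op_def
proof (rule the_equality)
  show "is_inverse_op A B" by fact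
next
  fix B' assume "is_inverse_op A B'"
  then have "B' (A x) = x" "A (B x) = x" for x
    using assms unfolding is_inverse_op_def blinfun_apply_inject[symmetric] fun_eq_iff by simp_all
  then show "B' = B" by (metis blinfun_eqI)
qed

lemma isometry_inner:
  fixes A :: "'a::real_inner \<Rightarrow>\<^sub>L 'b::real_inner"
  assumes "\<And>x. norm (A x) = norm x"
  shows "inner (A x) (A y) = inner x y"
  using assms[of "x + y"] by (simp add: dot_norm assms flip: blinfun.add_right)

text \<open>An isometry preserves \<open>inner\<close> by polarization, so the inverse
  \<open>\<rho> (- g)\<close> has to be the adjoint of \<open>\<rho> g\<close>.\<close>

lemma unitary_representationI:
  assumes \<rho>: "continuous_representation \<rho>" and iso: "\<And>g x. norm (\<rho> g x) = norm x"
  shows "unitary_representation \<rho>"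
proof -
  have rep: "\<rho> g \<in> bounded_ops" "\<rho> 0 = id_blinfun" "\<rho> (g + h) = \<rho> g o\<^sub>L \<rho> h" for g h
    using \<rho> by (auto simp: continuous_representation_def)
  have inv: "\<rho> g o\<^sub>L \<rho> (- g) = id_blinfun" "\<rho> (- g) o\<^sub>L \<rho> g = id_blinfun" for g
    by (simp_all flip: rep)
  have "adjoint_op (\<rho> g) = \<rho> (- g)" for g
  proof (rule adjoint_op_eqI[OF rep(1)])
    fix x y
    have "y = \<rho> g (\<rho> (- g) y)"
      using inv(1)[of g] by (metis blinfun_apply_blinfun_compose blinfun_apply_id_blinfun id_apply)
    then show "inner (\<rho> g x) y = inner x (\<rho> (- g) y)"
      using isometry_inner[OF iso, of g x "\<rho> (- g) y"] by simp
  qed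
  then show ?thesis using \<rho> inv by (simp add: unitary_representation_def)
qed

section \<open>Baire category and compactness principles\<close>

text \<open>The closed sets \<open>E n\<close> cover the space, so by Baire one of them contains a
  ball. Differences of points of that ball give a bound near the origin.\<close>

lemma uniform_boundedness:
  fixes T :: "'i \<Rightarrow> 'a::banach \<Rightarrow>\<^sub>L 'b::real_normed_vector"
  assumes bdd: "\<And>x. \<exists>B. \<forall>k\<in>K. norm (T k x) \<le> B"
  shows "\<exists>M\<ge>0. \<forall>k\<in>K. norm (T k) \<le> M"
proof -
  define E where "E n = {x. \<forall>k\<in>K. norm (T k x) \<le> real n}" for n
  have "closed (E n)" for n
    unfolding E_def Ball_def
    by (intro closed_Collect_all closed_Collect_imp open_Collect_const closed_Collect_le continuous_intros)
  moreover have "x \<in> (\<Union>n. E n)" for x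
  proof -
    obtain B where "\<forall>k\<in>K. norm (T k x) \<le> B" using bdd by blast
    moreover obtain n where "B \<le> real n" using real_arch_simple by blast
    ultimately show ?thesis by (auto simp: E_def intro: order_trans)
  qed
  then have "(\<Union>n. E n) = UNIV" by blast
  ultimately obtain n where "interior (E n) \<noteq> {}"
    using Baire_category_alt[of euclidean "range E"] completely_metrizable_space_euclidean
    by (auto simp: euclidean_interior_of)
  then obtain x0 e where e: "e > 0" "cball x0 e \<subseteq> E n"
    by (meson all_not_in_conv mem_interior_cball)
  have "norm (T k) \<le> 2 * real n / e" if k: "k \<in> K" for k
  proof (rule norm_blinfun_bound)
    fix x
    show "norm (T k x) \<le> 2 * real n / e * norm x"
    proof (cases "x = 0")
      case False
      define y where "y = (e / norm x) *\<^sub>R x"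
      have "x0 + y \<in> cball x0 e" "x0 \<in> cball x0 e" using e False by (auto simp: y_def dist_norm)
      then have "norm (T k (x0 + y)) \<le> n" "norm (T k x0) \<le> n"
        using subsetD[OF e(2)] k unfolding E_def by blast+
      moreover have "T k y = T k (x0 + y) - T k x0" by (simp add: blinfun.add_right)
      ultimately have "norm (T k y) \<le> 2 * real n"
        using norm_triangle_ineq4[of "T k (x0 + y)" "T k x0"] by simp
      then show ?thesis using False e by (simp add: y_def blinfun.scaleR_right field_simps)
    qed simp
  qed (use e in simp)
  then show ?thesis using e by (intro exI[of _ "2 * real n / e"]) simp
qed

text \<open>The product of the intervals is compact but, for an uncountable index set, need not be
  sequentially compact. Hence a filter \<open>H\<close> replaces a subsequence;
  \<open>H \<le> sequentially\<close> keeps ordinary limits valid along it.\<close>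

lemma bounded_functions_cluster_point:
  fixes f :: "nat \<Rightarrow> 'i \<Rightarrow> real"
  assumes bdd: "\<And>n i. \<bar>f n i\<bar> \<le> B i"
  obtains H l where "H \<noteq> bot" "H \<le> sequentially" "\<And>i. ((\<lambda>n. f n i) \<longlongrightarrow> l i) H"
proof -
  define U where "U = PiE UNIV (\<lambda>i. {- B i..B i})"
  have "compact U"
    using compactin_PiE[of "\<lambda>_. euclidean" UNIV "\<lambda>i. {- B i..B i}"]
    by (simp add: U_def euclidean_product_topology)
  moreover have "filtermap f sequentially \<noteq> bot" by (simp add: filtermap_bot_iff)
  moreover have "\<forall>\<^sub>F x in filtermap f sequentially. x \<in> U"
    using bdd by (auto simp: eventually_filtermap U_def abs_le_iff minus_le_iff
        intro!: always_eventually PiE_I)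
  ultimately obtain l where l: "inf (nhds l) (filtermap f sequentially) \<noteq> bot"
    unfolding compact_filter by blast
  \<comment> \<open>Pulling the neighbourhoods of \<open>l\<close> back along \<open>f\<close>
    forces convergence to \<open>l\<close>; the filter is proper because \<open>l\<close> is a
    cluster point.\<close>
  define H where "H = inf sequentially (filtercomap f (nhds l))"
  have "H \<noteq> bot"
  proof
    assume "H = bot"
    then obtain P Q where PQ: "eventually P sequentially" "eventually Q (nhds l)"
      "\<And>n. P n \<Longrightarrow> \<not> Q (f n)"
      unfolding H_def trivial_limit_def eventually_inf eventually_filtercomap by metis
    then have "eventually (\<lambda>n. \<not> Q (f n)) sequentially" by (auto elim: eventually_mono)
    then have "eventually (\<lambda>_. False) (inf (nhds l) (filtermap f sequentially))"
      unfolding eventually_inf eventually_filtermap using PQ(2)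
      by (intro exI[of _ Q] exI[of _ "\<lambda>x. \<not> Q x"]) simp
    then show False using l by (simp add: trivial_limit_def)
  qed
  moreover have "((\<lambda>n. f n i) \<longlongrightarrow> l i) H" for i
  proof -
    have "(f \<longlongrightarrow> l) H"
      unfolding H_def by (rule filterlim_mono[OF filterlim_filtercomap order_refl inf_le2])
    then show ?thesis
      unfolding tendsto_def
    proof safe
      fix S :: "real set" assume S: "open S" "l i \<in> S"
      have "open ((\<lambda>x. x i) -` S)"
        by (rule open_vimage[OF S(1) continuous_on_product_coordinates])
      with \<open>(f \<longlongrightarrow> l) H\<close> S(2) have "\<forall>\<^sub>F n in H. f n \<in> (\<lambda>x. x i) -` S"
        by (intro topological_tendstoD) auto
      then show "\<forall>\<^sub>F n in H. f n i \<in> S" by simp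
    qed
  qed
  ultimately show ?thesis using that[of H l] by (simp add: H_def)
qed

section \<open>Haar measure on sigma-compact groups\<close>

text \<open>Compactness leaves finitely many open boxes, whose union lies in the product algebra
  even if \<open>U\<close> itself does not.\<close>

lemma compact_subset_open_rectangles:
  fixes C :: "('a::topological_space \<times> 'b::topological_space) set"
  assumes "compact C" "open U" "C \<subseteq> U"
  obtains W where "W \<in> sets (borel \<Otimes>\<^sub>M borel)" "C \<subseteq> W" "W \<subseteq> U"
proof -
  have "\<exists>A B. open A \<and> open B \<and> w \<in> A \<times> B \<and> A \<times> B \<subseteq> U" if "w \<in> C" for w
    using open_prod_elim[OF \<open>open U\<close>] that \<open>C \<subseteq> U\<close> by (metis subsetD)
  then obtain A B where AB: "\<And>w. w \<in> C \<Longrightarrow> open (A w)" "\<And>w. w \<in> C \<Longrightarrow> open (B w)"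
    "\<And>w. w \<in> C \<Longrightarrow> w \<in> A w \<times> B w" "\<And>w. w \<in> C \<Longrightarrow> A w \<times> B w \<subseteq> U" by metis
  obtain D where D: "D \<subseteq> C" "finite D" "C \<subseteq> (\<Union>w\<in>D. A w \<times> B w)"
  proof (rule compactE_image[OF \<open>compact C\<close>, of C "\<lambda>w. A w \<times> B w"])
    show "C \<subseteq> (\<Union>w\<in>C. A w \<times> B w)" using AB(3) by blast
  qed (use AB in \<open>auto intro: open_Times\<close>)
  show ?thesis
  proof (rule that)
    show "(\<Union>w\<in>D. A w \<times> B w) \<in> sets (borel \<Otimes>\<^sub>M borel)"
      using D AB by (intro sets.finite_UN pair_measureI) auto
  qed (use D AB in blast)+
qed

text \<open>
  The product of the Borel algebras may be smaller than the Borel algebra of the product, since the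
  spaces need not be second countable.
\<close>

lemma borel_measurable_pair_continuous:
  fixes f :: "'a::topological_space \<times> 'b::topological_space \<Rightarrow> real"
  assumes "sigma_compact_space TYPE('a)" "sigma_compact_space TYPE('b)"
    and cont: "continuous_on UNIV f"
  shows "f \<in> borel_measurable (borel \<Otimes>\<^sub>M borel)"
proof (rule borel_measurable_iff_greater[THEN iffD2], rule allI)
  fix a
  obtain K :: "nat \<Rightarrow> 'a set" where K: "\<And>n. compact (K n)" "(\<Union>n. K n) = UNIV"
    using assms(1) by (auto simp: sigma_compact_space_def)
  obtain K' :: "nat \<Rightarrow> 'b set" where K': "\<And>n. compact (K' n)" "(\<Union>n. K' n) = UNIV"
    using assms(2) by (auto simp: sigma_compact_space_def)
  \<comment> \<open>The slack \<open>1 / Suc n\<close> makes the level set closed, so these are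
    countably many compact sets exhausting the open set where \<open>a < f w\<close>.\<close>
  define C where "C i j n = (K i \<times> K' j) \<inter> {w. a + 1 / Suc n \<le> f w}" for i j n
  have "compact (C i j n)" for i j n
    unfolding C_def using K K' cont
    by (intro compact_Int_closed compact_Times closed_Collect_le continuous_on_const)
  moreover have "open {w. a < f w}"
    using cont by (intro open_Collect_less continuous_on_const)
  moreover have C_sub: "C i j n \<subseteq> {w. a < f w}" for i j n
  proof
    fix w assume "w \<in> C i j n"
    then have "a + 1 / Suc n \<le> f w" by (simp add: C_def)
    moreover have "0 < 1 / real (Suc n)" by simp
    ultimately have "a < f w" by linarith
    then show "w \<in> {w. a < f w}" by simp
  qed
  ultimately have "\<exists>W. W \<in> sets (borel \<Otimes>\<^sub>M borel) \<and> C i j n \<subseteq> W \<and> W \<subseteq> {w. a < f w}" for i j n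
    by (meson compact_subset_open_rectangles)
  then obtain W where W: "\<And>i j n. W i j n \<in> sets (borel \<Otimes>\<^sub>M borel)"
    "\<And>i j n. C i j n \<subseteq> W i j n" "\<And>i j n. W i j n \<subseteq> {w. a < f w}" by metis
  have "{w. a < f w} = (\<Union>i. \<Union>j. \<Union>n. W i j n)"
  proof (intro equalityI subsetI)
    fix w assume "w \<in> {w. a < f w}"
    then obtain n where "1 / Suc n < f w - a"
      using reals_Archimedean[of "f w - a"] by (auto simp: inverse_eq_divide)
    moreover obtain i j where "fst w \<in> K i" "snd w \<in> K' j" using K(2) K'(2) by blast
    ultimately have "w \<in> C i j n" by (auto simp: C_def mem_Times_iff)
    then have "w \<in> W i j n" by (rule subsetD[OF W(2)])
    then show "w \<in> (\<Union>i. \<Union>j. \<Union>n. W i j n)" by (intro UN_I UNIV_I)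
  qed (use W(3) in blast)
  also have "\<dots> \<in> sets (borel \<Otimes>\<^sub>M borel)"
    by (intro sets.countable_UN image_subsetI W(1))
  finally show "{w \<in> space (borel \<Otimes>\<^sub>M borel). a < f w} \<in> sets (borel \<Otimes>\<^sub>M borel)"
    by (simp add: space_pair_measure)
qed

lemma continuous_on_uminus: "continuous_on UNIV (uminus :: 'a::topological_group_add \<Rightarrow> 'a)"
  by (intro continuous_on_minus continuous_on_id)

lemma uminus_vimage: "uminus -` E = uminus ` (E :: 'a::group_add set)"
  by (force simp: image_iff)

lemma open_uminus_image:
  fixes U :: "'a::topological_group_add set"
  shows "open U \<Longrightarrow> open (uminus ` U)"
  using open_vimage[OF _ continuous_on_uminus] by (simp add: uminus_vimage)

text \<open>Locally compact Hausdorff spaces are completely regular. The function vanishes off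
  \<open>U \<inter> V\<close> for a neighbourhood \<open>V\<close> of \<open>K\<close> inside the
  compact \<open>D\<close>, which will make its integral finite.\<close>

lemma Urysohn_compact_open:
  fixes K U :: "'a::t2_space set"
  assumes lc: "locally_compact_space (euclidean :: 'a topology)"
    and "compact K" "open U" "K \<subseteq> U"
  obtains f :: "'a \<Rightarrow> real" and D where "continuous_on UNIV f" "\<And>x. 0 \<le> f x" "\<And>x. f x \<le> 1"
    "\<And>x. x \<in> K \<Longrightarrow> f x = 1" "\<And>x. x \<notin> U \<inter> D \<Longrightarrow> f x = 0" "compact D"
proof -
  have H: "Hausdorff_space (euclidean :: 'a topology)"
    by (metis Hausdorff_space_def disjnt_def hausdorff open_openin)
  then have "\<exists>V D. openin euclidean V \<and> compactin euclidean D \<and> closedin euclidean D \<and> K \<subseteq> V \<and> V \<subseteq> D"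
    using lc \<open>compact K\<close> locally_compact_space_compact_closed_compact[of "euclidean :: 'a topology"]
    by auto
  then obtain V D where VD: "open V" "compact D" "K \<subseteq> V" "V \<subseteq> D" by auto
  have "completely_regular_space (euclidean :: 'a topology)"
    using locally_compact_regular_imp_completely_regular_space lc H by blast
  then obtain f :: "'a \<Rightarrow> real" where f: "continuous_map euclidean (top_of_set {0..1}) f"
    "f ` K \<subseteq> {1}" "f ` (- (U \<inter> V)) \<subseteq> {0}"
  proof (rule Urysohn_completely_regular_compact_closed[of 0 1 _ K "- (U \<inter> V)", rotated])
    show "closedin euclidean (- (U \<inter> V))"
      using \<open>open U\<close> \<open>open V\<close> by (metis closed_Compl open_Int closed_closedin)
  qed (use assms VD in \<open>auto simp: disjnt_def\<close>)
  show ?thesis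
  proof (rule that[of f D])
    show "continuous_on UNIV f" using f(1) by (auto simp: continuous_map_in_subtopology)
    show "0 \<le> f x" "f x \<le> 1" for x
      using f(1) by (auto simp: continuous_map_in_subtopology)
  qed (use f(2,3) VD in \<open>auto simp: image_subset_iff\<close>)
qed

section \<open>Invariance of the Haar measure under translation and inversion\<close>

locale sigma_compact_unimodular_group =
  fixes m :: "'g::{topological_group_add,t2_space} measure"
  assumes sigma_compact: "sigma_compact_space TYPE('g)"
    and locally_compact: "locally_compact_space (euclidean :: 'g topology)"
    and haar: "right_haar_measure m"
    and unimodular: "unimodular m"
begin

lemma sets_eq [measurable_cong]: "sets m = sets borel"
  using haar by (simp add: right_haar_measure_def)

lemma space_eq [simp]: "space m = UNIV"
  using sets_eq_imp_space_eq[OF sets_eq] by simp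

lemma emeasure_compact: "compact K \<Longrightarrow> emeasure m K < \<infinity>"
  using haar by (simp add: right_haar_measure_def)

lemma emeasure_right_translate: "E \<in> sets borel \<Longrightarrow> emeasure m (right_translate E s) = emeasure m E"
  using haar by (simp only: right_haar_measure_def)

lemma emeasure_outer_regular:
  "E \<in> sets borel \<Longrightarrow> emeasure m E = (INF U\<in>{U. open U \<and> E \<subseteq> U}. emeasure m U)"
  using haar by (simp only: right_haar_measure_def)

lemma emeasure_inner_regular:
  "open U \<Longrightarrow> emeasure m U = (SUP K\<in>{K. compact K \<and> K \<subseteq> U}. emeasure m K)"
  using haar by (simp only: right_haar_measure_def)

lemma distr_right_add: "distr m borel (\<lambda>x. x + s) = m"
proof (rule measure_eqI)
  fix E assume "E \<in> sets (distr m borel (\<lambda>x. x + s))"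
  then have E: "E \<in> sets borel" by simp
  have "(\<lambda>x. x + s) -` E = right_translate E (- s)"
    by (force simp: image_iff add.assoc)
  moreover have "(\<lambda>x. x + s) \<in> borel_measurable borel"
    by (intro borel_measurable_continuous_onI continuous_intros)
  ultimately show "emeasure (distr m borel (\<lambda>x. x + s)) E = emeasure m E"
    using E emeasure_right_translate[OF E, of "- s"]
    by (subst emeasure_distr) (simp_all add: measurable_cong_sets[OF sets_eq refl])
qed (simp add: sets_eq)

lemma distr_left_add: "distr m borel (\<lambda>x. s + x) = m"
proof (rule measure_eqI)
  fix E assume "E \<in> sets (distr m borel (\<lambda>x. s + x))"
  then have E: "E \<in> sets borel" by simp
  have "(\<lambda>x. s + x) -` E = (\<lambda>x. - s + x) ` E"
    by (force simp: image_iff add.assoc[symmetric])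
  moreover have "(\<lambda>x. s + x) \<in> borel_measurable borel"
    by (intro borel_measurable_continuous_onI continuous_intros)
  ultimately show "emeasure (distr m borel (\<lambda>x. s + x)) E = emeasure m E"
    using E unimodular by (subst emeasure_distr) 
      (simp_all add: unimodular_def measurable_cong_sets[OF sets_eq refl])
qed (simp add: sets_eq)

lemma nn_integral_right_add:
  assumes [measurable]: "f \<in> borel_measurable borel"
  shows "(\<integral>\<^sup>+x. f (x + s) \<partial>m) = (\<integral>\<^sup>+x. f x \<partial>m)"
proof -
  have [measurable]: "(\<lambda>x. x + s) \<in> borel_measurable m"
    by (simp add: measurable_cong_sets[OF sets_eq refl] borel_measurable_continuous_onI continuous_intros)
  show ?thesis by (subst (2) distr_right_add[of s, symmetric]) (simp add: nn_integral_distr)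
qed

lemma nn_integral_left_add:
  assumes [measurable]: "f \<in> borel_measurable borel"
  shows "(\<integral>\<^sup>+x. f (s + x) \<partial>m) = (\<integral>\<^sup>+x. f x \<partial>m)"
proof -
  have [measurable]: "(\<lambda>x. s + x) \<in> borel_measurable m"
    by (simp add: measurable_cong_sets[OF sets_eq refl] borel_measurable_continuous_onI continuous_intros)
  show ?thesis by (subst (2) distr_left_add[of s, symmetric]) (simp add: nn_integral_distr)
qed

text \<open>Compact sets have finite measure, so sigma-compactness provides the setting for
  Tonelli's theorem.\<close>

lemma sigma_finite: "sigma_finite_measure m"
proof
  obtain K :: "nat \<Rightarrow> 'g set" where K: "\<And>n. compact (K n)" "(\<Union>n. K n) = UNIV"
    using sigma_compact by (auto simp: sigma_compact_space_def)
  then have "range K \<subseteq> sets m" by (auto simp: sets_eq borel_compact)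
  then show "\<exists>A. countable A \<and> A \<subseteq> sets m \<and> \<Union> A = space m \<and> (\<forall>a\<in>A. emeasure m a \<noteq> \<infinity>)"
    using K emeasure_compact by (intro exI[of _ "range K"]) (auto simp: less_top)
qed

text \<open>
  Both sides are the integral of \<open>f (- x) * g (x + y)\<close>, computed in the two possible orders.
\<close>

lemma nn_integral_uminus_times:
  fixes f g :: "'g \<Rightarrow> real"
  assumes f: "continuous_on UNIV f" and g: "continuous_on UNIV g"
  shows "(\<integral>\<^sup>+x. f (- x) \<partial>m) * (\<integral>\<^sup>+x. g x \<partial>m) = (\<integral>\<^sup>+x. f x \<partial>m) * (\<integral>\<^sup>+x. g x \<partial>m)"
proof -
  interpret sigma_finite_measure m by (rule sigma_finite)
  interpret pair_sigma_finite m m ..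
  have [measurable]: "f \<in> borel_measurable borel" "g \<in> borel_measurable borel"
    using f g by (auto intro: borel_measurable_continuous_onI)
  have [measurable]: "(\<lambda>x. f (- x)) \<in> borel_measurable borel"
    "(\<lambda>x. f (y - x)) \<in> borel_measurable borel" "(\<lambda>y. f (y - x)) \<in> borel_measurable borel"
    "(\<lambda>y. g (x + y)) \<in> borel_measurable borel" for x y
    by (intro borel_measurable_continuous_onI continuous_on_compose2[OF f]
        continuous_on_compose2[OF g] continuous_intros subset_UNIV)+
  have "continuous_on UNIV (\<lambda>w::'g \<times> 'g. f (- fst w))" "continuous_on UNIV (\<lambda>w::'g \<times> 'g. g (fst w + snd w))"
    "continuous_on UNIV (\<lambda>w::'g \<times> 'g. f (snd w - fst w))"
    by (intro continuous_on_compose2[OF f] continuous_on_compose2[OF g] continuous_intros subset_UNIV)+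
  from this[THEN borel_measurable_pair_continuous[OF sigma_compact sigma_compact]]
  have [measurable]: "(\<lambda>w::'g \<times> 'g. f (- fst w)) \<in> borel_measurable (m \<Otimes>\<^sub>M m)"
    "(\<lambda>w::'g \<times> 'g. g (fst w + snd w)) \<in> borel_measurable (m \<Otimes>\<^sub>M m)"
    "(\<lambda>w::'g \<times> 'g. f (snd w - fst w)) \<in> borel_measurable (m \<Otimes>\<^sub>M m)"
    by (simp_all add: measurable_cong_sets[OF sets_pair_measure_cong[OF sets_eq sets_eq] refl])
  have "(\<integral>\<^sup>+x. f (- x) \<partial>m) * (\<integral>\<^sup>+y. g y \<partial>m) = (\<integral>\<^sup>+x. ennreal (f (- x)) * (\<integral>\<^sup>+y. g y \<partial>m) \<partial>m)"
    by (simp add: nn_integral_multc)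
  \<comment> \<open>Left invariance, hence unimodularity, enters here; the other two changes of
    variable use right invariance.\<close>
  also have "\<dots> = (\<integral>\<^sup>+x. ennreal (f (- x)) * (\<integral>\<^sup>+y. g (x + y) \<partial>m) \<partial>m)"
    using nn_integral_left_add[of "\<lambda>y. ennreal (g y)"] by simp
  also have "\<dots> = (\<integral>\<^sup>+x. \<integral>\<^sup>+y. ennreal (f (- x)) * ennreal (g (x + y)) \<partial>m \<partial>m)"
    by (intro nn_integral_cong nn_integral_cmult[symmetric]) measurable
  also have "\<dots> = (\<integral>\<^sup>+y. \<integral>\<^sup>+x. ennreal (f (- x)) * ennreal (g (x + y)) \<partial>m \<partial>m)"
    by (rule Fubini'[symmetric]) (simp add: split_beta')
  also have "\<dots> = (\<integral>\<^sup>+y. \<integral>\<^sup>+x. ennreal (f (y - x)) * ennreal (g x) \<partial>m \<partial>m)"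
  proof (rule nn_integral_cong)
    fix y
    have "y - (x + y) = - x" for x :: 'g
      by (simp add: diff_conv_add_uminus minus_add add.assoc[symmetric] del: add_uminus_conv_diff)
    then show "(\<integral>\<^sup>+x. ennreal (f (- x)) * ennreal (g (x + y)) \<partial>m) = (\<integral>\<^sup>+x. ennreal (f (y - x)) * ennreal (g x) \<partial>m)"
      using nn_integral_right_add[of "\<lambda>x. ennreal (f (y - x)) * ennreal (g x)" y]
      by simp
  qed
  also have "\<dots> = (\<integral>\<^sup>+x. \<integral>\<^sup>+y. ennreal (f (y - x)) * ennreal (g x) \<partial>m \<partial>m)"
    by (rule Fubini') (simp add: split_beta')
  also have "\<dots> = (\<integral>\<^sup>+x. (\<integral>\<^sup>+y. f (y - x) \<partial>m) * ennreal (g x) \<partial>m)"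
    by (simp add: nn_integral_multc)
  also have "\<dots> = (\<integral>\<^sup>+x. (\<integral>\<^sup>+y. f y \<partial>m) * ennreal (g x) \<partial>m)"
    using nn_integral_right_add[of "\<lambda>y. ennreal (f y)" "- x" for x] by simp
  also have "\<dots> = (\<integral>\<^sup>+x. f x \<partial>m) * (\<integral>\<^sup>+x. g x \<partial>m)"
    by (simp add: nn_integral_cmult)
  finally show ?thesis .
qed

text \<open>Take \<open>g = f\<close> in \<open>nn_integral_uminus_times\<close> for a cut-off
  \<open>f\<close> and cancel: \<open>f\<close> and its reflection have the same integral. The first
  dominates \<open>K\<close>, the second is dominated by the reflected \<open>U\<close>.\<close>

lemma emeasure_compact_le_uminus_open:
  assumes "compact K" "open U" "K \<subseteq> U"
  shows "emeasure m K \<le> emeasure m (uminus ` U)"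
proof (cases "emeasure m K = 0")
  case False
  obtain f :: "'g \<Rightarrow> real" and D where f: "continuous_on UNIV f" "\<And>x. 0 \<le> f x" "\<And>x. f x \<le> 1"
    "\<And>x. x \<in> K \<Longrightarrow> f x = 1" "\<And>x. x \<notin> U \<inter> D \<Longrightarrow> f x = 0" "compact D"
    using Urysohn_compact_open[OF locally_compact assms] by metis
  have sets: "K \<in> sets m" "D \<in> sets m"
    using assms f by (simp_all add: sets_eq borel_compact)
  have U: "uminus ` U \<in> sets m"
    using open_uminus_image[OF \<open>open U\<close>] by (simp add: sets_eq)
  have "emeasure m K = (\<integral>\<^sup>+x. indicator K x \<partial>m)" using sets by simp
  also have "\<dots> \<le> (\<integral>\<^sup>+x. f x \<partial>m)"
    using f by (intro nn_integral_mono) (auto simp: indicator_def)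
  finally have le: "emeasure m K \<le> (\<integral>\<^sup>+x. f x \<partial>m)" .
  have "(\<integral>\<^sup>+x. f x \<partial>m) \<le> (\<integral>\<^sup>+x. indicator D x \<partial>m)"
    using f(3,5) by (intro nn_integral_mono) (auto simp: indicator_def)
  then have "(\<integral>\<^sup>+x. f x \<partial>m) < \<infinity>"
    using emeasure_compact[OF \<open>compact D\<close>] sets by (simp add: order_le_less_trans)
  moreover have "(\<integral>\<^sup>+x. f x \<partial>m) \<noteq> 0" using le False by auto
  \<comment> \<open>Cancellation in \<open>ennreal\<close> is legitimate because the common factor
    is neither 0 nor infinite.\<close>
  ultimately have "(\<integral>\<^sup>+x. f x \<partial>m) = (\<integral>\<^sup>+x. f (- x) \<partial>m)"
    using nn_integral_uminus_times[OF f(1) f(1)] by (auto simp: ennreal_mult_cancel_left mult.commute)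
  also have "\<dots> \<le> (\<integral>\<^sup>+x. indicator (uminus ` U) x \<partial>m)"
  proof (rule nn_integral_mono)
    fix x
    have "- x \<in> U \<Longrightarrow> x \<in> uminus ` U" by (rule image_eqI[of _ _ "- x"]) simp_all
    then show "ennreal (f (- x)) \<le> indicator (uminus ` U) x"
      using f(3,5)[of "- x"] by (cases "- x \<in> U") (auto simp: indicator_def)
  qed
  finally show ?thesis using le U by (simp add: order_trans)
qed auto

text \<open>Inner regularity passes from compact to open sets, and applying the inequality to the
  reflected set reverses it.\<close>

lemma emeasure_uminus_open:
  assumes "open U"
  shows "emeasure m (uminus ` U) = emeasure m U"
proof -
  have *: "emeasure m V \<le> emeasure m (uminus ` V)" if "open V" for V
  proof -
    have "emeasure m V = (SUP K\<in>{K. compact K \<and> K \<subseteq> V}. emeasure m K)"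
      using that by (rule emeasure_inner_regular)
    also have "\<dots> \<le> emeasure m (uminus ` V)"
      using that by (intro SUP_least) (auto intro: emeasure_compact_le_uminus_open)
    finally show ?thesis .
  qed
  show ?thesis
    using *[OF assms] *[OF open_uminus_image[OF assms]] by (simp add: image_image antisym)
qed

text \<open>Outer regularity passes from open to Borel sets, with the same reversal by
  reflection.\<close>

lemma distr_uminus: "distr m borel uminus = m"
proof (rule measure_eqI)
  fix E assume "E \<in> sets (distr m borel uminus)"
  then have E: "E \<in> sets borel" by simp
  have meas: "(uminus :: 'g \<Rightarrow> 'g) \<in> borel_measurable borel"
    by (rule borel_measurable_continuous_onI[OF continuous_on_uminus])
  have le: "emeasure m (uminus ` E) \<le> emeasure m E" if "E \<in> sets borel" for E
  proof -
    have "emeasure m (uminus ` E) \<le> emeasure m U" if U: "open U" "E \<subseteq> U" for U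
    proof -
      have "emeasure m (uminus ` E) \<le> emeasure m (uminus ` U)"
        using U open_uminus_image[OF U(1)] by (intro emeasure_mono) (auto simp: sets_eq)
      then show ?thesis using emeasure_uminus_open U by simp
    qed
    then show ?thesis using that by (subst (2) emeasure_outer_regular) (auto intro: INF_greatest)
  qed
  have "uminus ` E \<in> sets borel"
    using measurable_sets[OF meas E] by (simp add: uminus_vimage)
  from le[OF this] le[OF E] have "emeasure m (uminus ` E) = emeasure m E"
    by (simp add: image_image antisym)
  then show "emeasure (distr m borel uminus) E = emeasure m E"
    using meas E by (subst emeasure_distr) (simp_all add: uminus_vimage measurable_cong_sets[OF sets_eq refl])
qed (simp add: sets_eq)

lemma nn_integral_uminus:
  assumes [measurable]: "f \<in> borel_measurable borel"
  shows "(\<integral>\<^sup>+x. f (- x) \<partial>m) = (\<integral>\<^sup>+x. f x \<partial>m)"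
proof -
  have [measurable]: "uminus \<in> borel_measurable m"
    by (simp add: measurable_cong_sets[OF sets_eq refl]
      borel_measurable_continuous_onI[OF continuous_on_uminus])
  show ?thesis by (subst (2) distr_uminus[symmetric]) (simp add: nn_integral_distr)
qed

end

section \<open>Averages along a Folner sequence\<close>

lemma average_eq_uniform_measure:
  assumes "f \<in> borel_measurable m" "A \<in> sets m"
  shows "average m A f = (\<integral>\<^sup>+h. ennreal (f h) \<partial>uniform_measure m A)"
  using assms by (subst nn_integral_uniform_measure) (auto simp: average_def)

lemma average_mono:
  "(\<And>h. h \<in> A \<Longrightarrow> f h \<le> g h) \<Longrightarrow> average m A f \<le> average m A g"
  unfolding average_def
  by (intro divide_right_mono_ennreal nn_integral_mono) (auto simp: indicator_def ennreal_leI)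

lemma average_const:
  assumes "A \<in> sets m" "emeasure m A \<noteq> 0" "emeasure m A \<noteq> \<infinity>"
  shows "average m A (\<lambda>_. c) = ennreal c"
  using assms by (simp add: average_def nn_integral_cmult_indicator ennreal_mult_divide_eq)

lemma average_cmult:
  assumes [measurable]: "f \<in> borel_measurable m" "A \<in> sets m" and "0 \<le> c"
  shows "average m A (\<lambda>h. c * f h) = ennreal c * average m A f"
  using assms by (simp add: average_def ennreal_mult' mult.assoc nn_integral_cmult
      ennreal_times_divide)

lemma average_add:
  assumes [measurable]: "f \<in> borel_measurable m" "g \<in> borel_measurable m" "A \<in> sets m"
    and "\<And>h. 0 \<le> f h" "\<And>h. 0 \<le> g h"
  shows "average m A (\<lambda>h. f h + g h) = average m A f + average m A g"
  using assms by (simp add: average_def ennreal_plus distrib_right nn_integral_add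
      add_divide_distrib_ennreal)

lemma continuous_representationD:
  assumes "continuous_representation \<pi>"
  shows "\<pi> g \<in> bounded_ops" "\<pi> 0 = id_blinfun" "\<pi> (g + h) = \<pi> g o\<^sub>L \<pi> h"
    and "continuous_on UNIV (\<lambda>g. \<pi> g x)"
  using assms
  by (auto simp: continuous_representation_def continuous_on_strong_operator_topo_iff_coordinatewise)

lemma representation_inverse:
  assumes "continuous_representation \<pi>"
  shows "\<pi> (- g) (\<pi> g x) = x" "\<pi> g (\<pi> (- g) x) = x"
  using continuous_representationD(2)[OF assms] continuous_representationD(3)[OF assms, of "- g" g]
    continuous_representationD(3)[OF assms, of g "- g"]
  by (simp_all flip: blinfun_apply_blinfun_compose)

text \<open>Taking adjoints does not preserve strong continuity in general. But the norm is a
  supremum of the continuous functions \<open>inner (\<pi> g y) x\<close>, hence lower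
  semicontinuous.\<close>

lemma borel_measurable_norm_adjoint:
  fixes \<pi> :: "'g::topological_space \<Rightarrow> 'h::complex_hilbert_space \<Rightarrow>\<^sub>L 'h"
  assumes cont: "\<And>x. continuous_on UNIV (\<lambda>g. \<pi> g x)" and ops: "\<And>g. \<pi> g \<in> bounded_ops"
  shows "(\<lambda>g. norm (adjoint_op (\<pi> g) x)) \<in> borel_measurable borel"
proof (rule borel_measurable_iff_greater[THEN iffD2], rule allI)
  fix a
  have less_norm: "a < norm v \<longleftrightarrow> (\<exists>y. norm y \<le> 1 \<and> a < inner y v)" for v :: 'h
  proof
    assume a: "a < norm v"
    show "\<exists>y. norm y \<le> 1 \<and> a < inner y v"
    proof (cases "v = 0")
      case False
      then have "inner ((1 / norm v) *\<^sub>R v) v = norm v"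
        by (simp add: power2_norm_eq_inner[symmetric] power2_eq_square)
      then show ?thesis using a False by (intro exI[of _ "(1 / norm v) *\<^sub>R v"]) simp
    qed (use a in \<open>auto intro: exI[of _ 0]\<close>)
  next
    assume "\<exists>y. norm y \<le> 1 \<and> a < inner y v"
    then obtain y where "norm y \<le> 1" "a < inner y v" by blast
    moreover have "inner y v \<le> norm y * norm v" by (rule norm_cauchy_schwarz)
    moreover have "norm y * norm v \<le> 1 * norm v"
      using \<open>norm y \<le> 1\<close> by (rule mult_right_mono) simp
    ultimately show "a < norm v" by simp
  qed
  have "{g. a < norm (adjoint_op (\<pi> g) x)} = (\<Union>y\<in>{y. norm y \<le> 1}. {g. a < inner (\<pi> g y) x})"
    by (auto simp: less_norm inner_adjoint_op[OF ops])
  moreover have "open \<dots>"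
    by (intro open_UN ballI open_Collect_less continuous_on_const continuous_on_inner cont)
  ultimately show "{g \<in> space borel. a < norm (adjoint_op (\<pi> g) x)} \<in> sets borel" by simp
qed

text \<open>Moving \<open>\<pi> (- h)\<close> across the pairing gives
  \<open>(norm x)\<^sup>2\<close>; Cauchy-Schwarz and a weighted arithmetic-geometric mean
  inequality then separate the factors. The weight \<open>t\<close> is left free to balance the two
  averages.\<close>

lemma norm_power2_le_adjoint:
  assumes \<pi>: "continuous_representation \<pi>" and "0 < t"
  shows "(norm x)\<^sup>2 \<le> t / 2 * (norm (\<pi> h x))\<^sup>2 + 1 / (2 * t) * (norm (adjoint_op (\<pi> (- h)) x))\<^sup>2"
proof -
  let ?p = "norm (\<pi> h x)" and ?a = "norm (adjoint_op (\<pi> (- h)) x)"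
  have "(norm x)\<^sup>2 = inner (\<pi> h x) (adjoint_op (\<pi> (- h)) x)"
    by (simp add: power2_norm_eq_inner continuous_representationD(1)[OF \<pi>]
      representation_inverse[OF \<pi>] flip: inner_adjoint_op)
  also have "\<dots> \<le> ?p * ?a" by (rule norm_cauchy_schwarz)
  also have "2 * t * (?p * ?a) \<le> (t * ?p)\<^sup>2 + ?a\<^sup>2"
    using sum_squares_bound[of "t * ?p" ?a] by (simp add: mult_ac)
  then have "?p * ?a \<le> t / 2 * ?p\<^sup>2 + 1 / (2 * t) * ?a\<^sup>2"
    using \<open>0 < t\<close> by (simp add: field_simps power2_eq_square)
  finally show ?thesis .
qed

lemma borel_right_translate:
  fixes A :: "'g::{topological_group_add, t2_space} set"
  assumes "A \<in> sets borel"
  shows "right_translate A g \<in> sets borel"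
proof -
  have "right_translate A g = (\<lambda>x. x + - g) -` A"
    by (force simp: image_iff)
  moreover have "(\<lambda>x. x + - g) \<in> borel_measurable borel"
    by (intro borel_measurable_continuous_onI continuous_intros)
  ultimately show ?thesis
    using measurable_sets[of _ borel borel A] assms by simp
qed

context sigma_compact_unimodular_group
begin

lemma average_right_translate:
  assumes [measurable]: "f \<in> borel_measurable borel" "A \<in> sets borel"
  shows "average m A (\<lambda>h. f (h + g)) = average m (right_translate A g) f"
proof -
  have [measurable]: "right_translate A g \<in> sets borel"
    using assms(2) by (rule borel_right_translate)
  have "indicator A h = (indicator (right_translate A g) (h + g) :: ennreal)" for h
    by (auto simp: indicator_def)
  then have "(\<integral>\<^sup>+h\<in>A. f (h + g) \<partial>m) = (\<integral>\<^sup>+h\<in>right_translate A g. f h \<partial>m)"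
    using nn_integral_right_add[of "\<lambda>h. ennreal (f h) * indicator (right_translate A g) h" g]
    by simp
  then show ?thesis by (simp add: average_def emeasure_right_translate)
qed

lemma average_uminus:
  assumes [measurable]: "f \<in> borel_measurable borel" "A \<in> sets borel" and "uminus ` A = A"
  shows "average m A (\<lambda>h. f (- h)) = average m A f"
proof -
  have "indicator A h = (indicator A (- h) :: ennreal)" for h
    using \<open>uminus ` A = A\<close> by (auto simp: indicator_def) (metis image_eqI minus_minus)+
  then show ?thesis
    using nn_integral_uminus[of "\<lambda>h. ennreal (f h) * indicator A h"] by (simp add: average_def)
qed

text \<open>Shifting the variable replaces \<open>A\<close> by its translate, which differs from
  \<open>A\<close> only on the symmetric difference, where \<open>f\<close> is at most
  \<open>D\<close>.\<close>

lemma average_right_shift_le: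
  assumes [measurable]: "f \<in> borel_measurable borel" "A \<in> sets borel"
    and A: "emeasure m A \<noteq> 0" "emeasure m A \<noteq> \<infinity>" and f: "\<And>h. 0 \<le> f h" "\<And>h. f h \<le> D"
  shows "average m A (\<lambda>h. f (h + g))
    \<le> average m A f + ennreal (D * (measure m (sym_diff (right_translate A g) A) / measure m A))"
proof -
  let ?B = "right_translate A g"
  have [measurable]: "?B \<in> sets borel"
    using assms(2) by (rule borel_right_translate)
  have "0 \<le> D" using f[of 0] by linarith
  have pos: "0 < measure m A" using A by (simp add: measure_def enn2real_positive_iff less_top zero_less_iff_neq_zero)
  \<comment> \<open>\<open>measure\<close> sends infinite values to 0, so finiteness must precede
    the passage from \<open>emeasure\<close> to the real quotient.\<close>
  have fin: "emeasure m (sym_diff ?B A) \<noteq> \<infinity>"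
  proof -
    have "emeasure m (sym_diff ?B A) \<le> emeasure m (?B \<union> A)"
      by (intro emeasure_mono) (auto simp: sets_eq)
    also have "\<dots> \<le> emeasure m ?B + emeasure m A"
      by (intro emeasure_subadditive) (auto simp: sets_eq)
    also have "\<dots> < \<infinity>" using A by (simp add: emeasure_right_translate less_top)
    finally show ?thesis by simp
  qed
  have "(\<integral>\<^sup>+h\<in>?B. f h \<partial>m)
      \<le> (\<integral>\<^sup>+h. ennreal (f h) * indicator A h + ennreal D * indicator (sym_diff ?B A) h \<partial>m)"
    using f by (intro nn_integral_mono) (auto simp: indicator_def ennreal_leI)
  also have "\<dots> = (\<integral>\<^sup>+h\<in>A. f h \<partial>m) + ennreal D * emeasure m (sym_diff ?B A)"
    by (subst nn_integral_add) (auto simp: nn_integral_cmult sets_eq)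
  finally have "average m A (\<lambda>h. f (h + g))
      \<le> ((\<integral>\<^sup>+h\<in>A. f h \<partial>m) + ennreal D * emeasure m (sym_diff ?B A)) / emeasure m A"
    unfolding average_right_translate[OF assms(1,2)]
    by (simp add: average_def emeasure_right_translate divide_right_mono_ennreal)
  also have "\<dots> = average m A f + ennreal D * emeasure m (sym_diff ?B A) / emeasure m A"
    by (simp add: average_def add_divide_distrib_ennreal)
  also have "ennreal D * emeasure m (sym_diff ?B A) / emeasure m A
      = ennreal (D * (measure m (sym_diff ?B A) / measure m A))"
    using A fin pos \<open>0 \<le> D\<close>
    by (simp add: emeasure_eq_ennreal_measure ennreal_mult'[symmetric] divide_ennreal)
  finally show ?thesis .
qed

text \<open>
  Averaging \<open>\<pi> g x = \<pi> (- k) (\<pi> (k + g) x)\<close> over \<open>k \<in> K\<close> bounds \<open>\<pi>\<close> on the whole group; the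
  factors \<open>\<pi> (- k)\<close> are uniformly bounded by the Banach-Steinhaus theorem.
\<close>

lemma representation_bounded:
  assumes \<pi>: "continuous_representation \<pi>"
    and K: "compact K" "emeasure m K \<noteq> 0"
    and avg: "\<And>g x. average m (right_translate K g) (\<lambda>h. (norm (\<pi> h x))\<^sup>2) \<le> ennreal (C * (norm x)\<^sup>2)"
    and "0 \<le> C"
  obtains M where "0 < M" "\<And>g x. norm (\<pi> g x) \<le> M * norm x"
proof -
  note rep = continuous_representationD[OF \<pi>]
  have cont: "continuous_on UNIV (\<lambda>k. \<pi> (- k) x)" for x
    by (rule continuous_on_compose2[OF rep(4) continuous_on_uminus]) simp
  have "\<exists>B. \<forall>k\<in>K. norm (\<pi> (- k) x) \<le> B" for x
  proof -
    have "bounded ((\<lambda>k. \<pi> (- k) x) ` K)"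
      by (intro compact_imp_bounded compact_continuous_image K continuous_on_subset[OF cont]) simp
    then show ?thesis by (auto simp: bounded_iff)
  qed
  then obtain N where N: "0 \<le> N" "\<And>k. k \<in> K \<Longrightarrow> norm (\<pi> (- k)) \<le> N"
    using uniform_boundedness[of K "\<lambda>k. \<pi> (- k)"] by metis
  \<comment> \<open>The summand 1 makes the constant strictly positive.\<close>
  have "norm (\<pi> g x) \<le> (N * sqrt C + 1) * norm x" for g x
  proof -
    have sets: "K \<in> sets borel" using K by (simp add: borel_compact)
    have le: "(norm (\<pi> g x))\<^sup>2 \<le> N\<^sup>2 * (norm (\<pi> h x))\<^sup>2" if h: "h \<in> right_translate K g" for h
    proof -
      obtain k where k: "k \<in> K" "h = k + g" using h by blast
      have "\<pi> g x = \<pi> (- k) (\<pi> h x)"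
        using rep(3)[of "- k" h] by (simp add: k(2) add.assoc[symmetric])
      then have "norm (\<pi> g x) \<le> norm (\<pi> (- k)) * norm (\<pi> h x)" by (simp add: norm_blinfun)
      also have "\<dots> \<le> N * norm (\<pi> h x)" using N(2)[OF k(1)] by (rule mult_right_mono) simp
      finally have "(norm (\<pi> g x))\<^sup>2 \<le> (N * norm (\<pi> h x))\<^sup>2" by (rule power_mono) simp
      then show ?thesis by (simp add: power_mult_distrib)
    qed
    have "compact (right_translate K g)"
      by (intro compact_continuous_image continuous_intros K)
    then have B: "right_translate K g \<in> sets m" "emeasure m (right_translate K g) \<noteq> \<infinity>"
      "emeasure m (right_translate K g) \<noteq> 0"
      using K(2) sets emeasure_compact[of "right_translate K g"]
      by (auto simp: sets_eq borel_compact emeasure_right_translate)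
    have meas: "(\<lambda>h. (norm (\<pi> h x))\<^sup>2) \<in> borel_measurable m"
      by (simp add: measurable_cong_sets[OF sets_eq refl])
        (intro borel_measurable_continuous_onI continuous_intros rep(4))
    have "ennreal ((norm (\<pi> g x))\<^sup>2) = average m (right_translate K g) (\<lambda>h. (norm (\<pi> g x))\<^sup>2)"
      using B by (simp add: average_const)
    also have "\<dots> \<le> average m (right_translate K g) (\<lambda>h. N\<^sup>2 * (norm (\<pi> h x))\<^sup>2)"
      by (rule average_mono[OF le])
    also have "\<dots> = ennreal (N\<^sup>2) * average m (right_translate K g) (\<lambda>h. (norm (\<pi> h x))\<^sup>2)"
      using B meas by (simp add: average_cmult)
    also have "\<dots> \<le> ennreal (N\<^sup>2) * ennreal (C * (norm x)\<^sup>2)"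
      by (intro mult_left_mono avg) simp
    also have "\<dots> = ennreal ((N * sqrt C * norm x)\<^sup>2)"
      using \<open>0 \<le> C\<close> by (simp add: ennreal_mult'[symmetric] power_mult_distrib mult_ac)
    finally have "(norm (\<pi> g x))\<^sup>2 \<le> (N * sqrt C * norm x)\<^sup>2" by (simp add: ennreal_le_iff)
    then have "norm (\<pi> g x) \<le> N * sqrt C * norm x"
      by (rule power2_le_imp_le) (use N(1) \<open>0 \<le> C\<close> in simp)
    also have "\<dots> \<le> (N * sqrt C + 1) * norm x" by (simp add: distrib_right)
    finally show ?thesis .
  qed
  moreover have "0 < N * sqrt C + 1" using N(1) \<open>0 \<le> C\<close> by (simp add: add_nonneg_pos)
  ultimately show ?thesis using that by blast
qed

end

section \<open>Unitarization\<close>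

text \<open>\<open>R\<close> is an isometry from the norm given by \<open>b\<close> onto the
  original norm, so conjugating by it turns \<open>b\<close>-isometries into isometries. Invariance
  on the diagonal is enough, since \<open>unitary_representationI\<close> asks only about
  norms.\<close>

lemma unitary_conjugate_of_invariant_form:
  fixes \<pi> :: "'g::topological_group_add \<Rightarrow> 'h::complex_hilbert_space \<Rightarrow>\<^sub>L 'h"
  assumes \<pi>: "continuous_representation \<pi>" and "0 < C"
    and b: "bounded_bilinear b" "\<And>x y. b x y = b y x" "\<And>c x y. b (c *\<^sub>C x) y = b x (cnj c *\<^sub>C y)"
    and lower: "\<And>x. (norm x)\<^sup>2 \<le> C\<^sup>2 * b x x" and upper: "\<And>x. b x x \<le> C\<^sup>2 * (norm x)\<^sup>2"
    and inv: "\<And>g x. b (\<pi> g x) (\<pi> g x) = b x x"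
  obtains L where "invertible_op L" "norm (inverse_op L) * norm L \<le> C\<^sup>2"
    "unitary_representation (conjugate_rep L \<pi>)"
proof -
  note rep = continuous_representationD[OF \<pi>]
  obtain S :: "'h \<Rightarrow>\<^sub>L 'h" where S: "\<And>x y. b x y = inner (S x) y"
    using bounded_bilinear_imp_operator[OF b(1)] by blast
  have "inner (S x) y = inner x (S y)" for x y
    using b(2)[of x y] by (simp add: S inner_commute)
  moreover have "0 < 1 / C\<^sup>2" "0 < C\<^sup>2" using \<open>0 < C\<close> by simp_all
  moreover have "1 / C\<^sup>2 * (norm x)\<^sup>2 \<le> inner (S x) x" "inner (S x) x \<le> C\<^sup>2 * (norm x)\<^sup>2" for x
    using lower[of x] upper[of x] \<open>0 < C\<close> by (simp_all add: S field_simps)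
  ultimately obtain R L :: "'h \<Rightarrow>\<^sub>L 'h"
    where RL: "R o\<^sub>L L = id_blinfun" and LR: "L o\<^sub>L R = id_blinfun"
      and norm_R: "\<And>x. (norm (R x))\<^sup>2 = inner (S x) x"
      and comm: "\<And>Z :: 'h \<Rightarrow>\<^sub>L 'h. S o\<^sub>L Z = Z o\<^sub>L S \<Longrightarrow> R o\<^sub>L Z = Z o\<^sub>L R"
    using positive_operator_sqrt[of S "1 / C\<^sup>2" "C\<^sup>2"] by metis
  have RL': "R (L x) = x" and LR': "L (R x) = x" for x
    using RL LR by (simp_all flip: blinfun_apply_blinfun_compose)
  have "S \<in> bounded_ops" by (rule bounded_opsI_form) (simp add: b(3) flip: S)
  then have R_ops: "R \<in> bounded_ops" using comm by (simp add: bounded_ops_iff_commute)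
  have L_ops: "L \<in> bounded_ops"
    unfolding bounded_ops_def
  proof safe
    fix c x
    have "L (c *\<^sub>C R (L x)) = L (R (c *\<^sub>C L x))"
      using R_ops by (simp add: bounded_ops_def)
    then show "L (c *\<^sub>C x) = c *\<^sub>C L x" by (simp add: RL' LR')
  qed
  have "is_inverse_op L R" using R_ops RL LR by (simp add: is_inverse_op_def)
  then have L: "inverse_op L = R" "invertible_op L"
    using L_ops by (auto simp: inverse_op_eqI invertible_op_def)
  have "norm (R x) \<le> C * norm x" for x
    by (rule power2_le_imp_le) (use upper[of x] \<open>0 < C\<close> in \<open>auto simp: norm_R S power_mult_distrib\<close>)
  then have nR: "norm R \<le> C" using \<open>0 < C\<close> by (intro norm_blinfun_bound) auto
  \<comment> \<open>The lower bound at \<open>L x\<close> reads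
    \<open>(norm (L x))\<^sup>2 \<le> C\<^sup>2 * (norm x)\<^sup>2\<close>, because
    \<open>R (L x) = x\<close>.\<close>
  have "norm (L x) \<le> C * norm x" for x
    by (rule power2_le_imp_le)
      (use lower[of "L x"] norm_R[of "L x"] \<open>0 < C\<close> in \<open>auto simp: RL' S power_mult_distrib\<close>)
  then have nL: "norm L \<le> C" using \<open>0 < C\<close> by (intro norm_blinfun_bound) auto
  have "norm R * norm L \<le> C * C"
    using nR nL \<open>0 < C\<close> by (intro mult_mono) auto
  then have norms: "norm (inverse_op L) * norm L \<le> C\<^sup>2" by (simp add: L power2_eq_square)
  define \<rho> where "\<rho> g = R o\<^sub>L \<pi> g o\<^sub>L L" for g
  have "continuous_representation \<rho>"
    unfolding continuous_representation_def continuous_on_strong_operator_topo_iff_coordinatewise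
  proof (intro conjI allI)
    show "\<rho> g \<in> bounded_ops" for g
      by (simp add: \<rho>_def bounded_ops_compose R_ops L_ops rep)
    show "\<rho> 0 = id_blinfun" "\<rho> (g + h) = \<rho> g o\<^sub>L \<rho> h" for g h
      by (auto intro!: blinfun_eqI simp: \<rho>_def rep RL' LR')
    show "continuous_map euclidean euclidean (\<lambda>g. \<rho> g x)" for x
      by (simp add: \<rho>_def) (intro continuous_intros rep(4))
  qed
  moreover have "norm (\<rho> g x) = norm x" for g x
  proof -
    have "(norm (\<rho> g x))\<^sup>2 = b (\<pi> g (L x)) (\<pi> g (L x))" by (simp add: \<rho>_def norm_R S)
    also have "\<dots> = (norm (R (L x)))\<^sup>2" unfolding inv by (simp add: norm_R S)
    finally show ?thesis by (simp add: RL' power2_eq_iff_nonneg)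
  qed
  ultimately have "unitary_representation \<rho>" by (rule unitary_representationI)
  then show ?thesis
    using that[OF L(2) norms] by (simp add: conjugate_rep_def L \<rho>_def[abs_def])
qed

context sigma_compact_unimodular_group
begin

text \<open>Bilinearity, symmetry and both bounds hold for every averaged form and pass to the limit
  along \<open>H\<close>. Invariance holds for the averages only up to a Folner error that tends to
  0.\<close>

lemma invariant_form:
  fixes \<pi> :: "'g \<Rightarrow> 'h::complex_hilbert_space \<Rightarrow>\<^sub>L 'h"
  assumes F: "symmetric_folner_sequence m F" and \<pi>: "continuous_representation \<pi>" and "0 < C"
    and avg: "\<And>N x g. N \<ge> 1 \<Longrightarrow>
      average m (right_translate (F N) g) (\<lambda>h. (norm (\<pi> h x))\<^sup>2) \<le> ennreal (C\<^sup>2 * (norm x)\<^sup>2)"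
    and avg_adj: "\<And>N x. N \<ge> 1 \<Longrightarrow>
      average m (F N) (\<lambda>h. (norm (adjoint_op (\<pi> h) x))\<^sup>2) \<le> ennreal (C\<^sup>2 * (norm x)\<^sup>2)"
  obtains b where "bounded_bilinear b" "\<And>x y. b x y = b y x"
    "\<And>c x y. b (c *\<^sub>C x) y = b x (cnj c *\<^sub>C y)"
    "\<And>x. (norm x)\<^sup>2 \<le> C\<^sup>2 * b x x" "\<And>x. b x x \<le> C\<^sup>2 * (norm x)\<^sup>2"
    "\<And>g x. b (\<pi> g x) (\<pi> g x) = b x x"
proof -
  note rep = continuous_representationD[OF \<pi>]
  \<comment> \<open>The shift of index avoids \<open>F 0\<close>, about which nothing is
    assumed.\<close>
  define A where "A n = F (Suc n)" for n
  define r where "r n g = measure m (sym_diff (right_translate (A n) g) (A n)) / measure m (A n)" for n g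
  have A: "compact (A n)" "A n \<in> sets borel" "emeasure m (A n) \<noteq> 0" "emeasure m (A n) \<noteq> \<infinity>"
    "uminus ` A n = A n" for n
  proof -
    have "\<forall>N\<ge>1. compact (F N) \<and> 0 < emeasure m (F N) \<and> emeasure m (F N) < \<infinity> \<and> uminus ` F N = F N"
      using F unfolding symmetric_folner_sequence_def by (rule conjunct1)
    from this[rule_format, of "Suc n"]
    show "compact (A n)" "A n \<in> sets borel" "emeasure m (A n) \<noteq> 0" "emeasure m (A n) \<noteq> \<infinity>"
      "uminus ` A n = A n" by (auto simp: A_def borel_compact)
  qed
  have r_lim: "(\<lambda>n. r n g) \<longlonglongrightarrow> 0" for g
    using F unfolding symmetric_folner_sequence_def r_def A_def
    by (intro LIMSEQ_Suc[where f = "\<lambda>N. measure m (sym_diff (right_translate (F N) g) (F N)) / measure m (F N)"])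
      simp
  \<comment> \<open>The bound makes the integrands below bounded, which gives integrability, the box
    for Tychonoff's theorem and the constant in the Folner error.\<close>
  obtain M where M: "0 < M" "\<And>g x. norm (\<pi> g x) \<le> M * norm x"
  proof (rule representation_bounded[OF \<pi> A(1,3)[of 0], where C = "C\<^sup>2"])
    show "average m (right_translate (A 0) g) (\<lambda>h. (norm (\<pi> h x))\<^sup>2) \<le> ennreal (C\<^sup>2 * (norm x)\<^sup>2)"
      for g x using avg[of "Suc 0"] by (simp add: A_def)
  qed simp_all
  define U where "U n = uniform_measure m (A n)" for n
  have U: "finite_measure (U n)" "measure (U n) UNIV = 1" for n
  proof -
    have "emeasure (U n) (space (U n)) = 1"
      using A[of n] by (simp add: U_def sets_eq ennreal_divide_self top.not_eq_extremum)
    then show "finite_measure (U n)" "measure (U n) UNIV = 1"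
      by (auto intro!: finite_measureI simp: U_def measure_def)
  qed
  have sets_U [measurable_cong]: "sets (U n) = sets borel" for n by (simp add: U_def sets_eq)
  have cont: "continuous_on UNIV (\<lambda>h. inner (\<pi> h x) (\<pi> h y))" for x y
    by (intro continuous_on_inner rep(4))
  have meas [measurable]: "(\<lambda>h. inner (\<pi> h x) (\<pi> h y)) \<in> borel_measurable borel" for x y
    by (rule borel_measurable_continuous_onI[OF cont])
  have inner_le: "\<bar>inner (\<pi> h x) (\<pi> h y)\<bar> \<le> M\<^sup>2 * (norm x * norm y)" for h x y
  proof -
    have "\<bar>inner (\<pi> h x) (\<pi> h y)\<bar> \<le> norm (\<pi> h x) * norm (\<pi> h y)"
      by (rule Cauchy_Schwarz_ineq2)
    also have "\<dots> \<le> (M * norm x) * (M * norm y)"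
      using M by (intro mult_mono) auto
    finally show ?thesis by (simp add: power2_eq_square mult_ac)
  qed
  have int: "integrable (U n) (\<lambda>h. inner (\<pi> h x) (\<pi> h y))" for n x y
    using inner_le by (intro finite_measure.integrable_const_bound[OF U(1)]) (auto intro!: AE_I2)
  define \<beta> where "\<beta> n = (\<lambda>(x, y). \<integral>h. inner (\<pi> h x) (\<pi> h y) \<partial>U n)" for n
  have \<beta>_le: "\<bar>\<beta> n p\<bar> \<le> M\<^sup>2 * (norm (fst p) * norm (snd p))" for n p
  proof -
    interpret finite_measure "U n" by (rule U)
    have "\<bar>\<beta> n p\<bar> \<le> (\<integral>h. \<bar>inner (\<pi> h (fst p)) (\<pi> h (snd p))\<bar> \<partial>U n)"
      unfolding \<beta>_def split_beta by (rule integral_abs_bound)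
    also have "\<dots> \<le> (\<integral>h. M\<^sup>2 * (norm (fst p) * norm (snd p)) \<partial>U n)"
      using int inner_le by (intro integral_mono integrable_abs) auto
    finally show ?thesis using U(2)[of n] by (simp add: U_def)
  qed
  \<comment> \<open>Linearity is read off the Bochner integral, the hypotheses concern
    \<open>average\<close>; this identity connects them.\<close>
  have \<beta>_diag: "ennreal (\<beta> n (x, x)) = average m (A n) (\<lambda>h. (norm (\<pi> h x))\<^sup>2)" and
    \<beta>_nonneg: "0 \<le> \<beta> n (x, x)" for n x
  proof -
    show "0 \<le> \<beta> n (x, x)" by (simp add: \<beta>_def)
    have "average m (A n) (\<lambda>h. (norm (\<pi> h x))\<^sup>2) = (\<integral>\<^sup>+h. inner (\<pi> h x) (\<pi> h x) \<partial>U n)"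
      using A(2)[of n] unfolding U_def power2_norm_eq_inner
      by (intro average_eq_uniform_measure) (simp_all add: sets_eq measurable_cong_sets[OF sets_eq refl])
    then show "ennreal (\<beta> n (x, x)) = average m (A n) (\<lambda>h. (norm (\<pi> h x))\<^sup>2)"
      using int by (simp add: \<beta>_def nn_integral_eq_integral)
  qed
  obtain H l where H: "H \<noteq> bot" "H \<le> sequentially" and l: "\<And>p. ((\<lambda>n. \<beta> n p) \<longlongrightarrow> l p) H"
  proof (rule bounded_functions_cluster_point[where f = \<beta>])
    show "\<bar>\<beta> n p\<bar> \<le> M\<^sup>2 * (norm (fst p) * norm (snd p))" for n p by (rule \<beta>_le)
  qed (rule that)
  have l_eqI: "l p = c" if "((\<lambda>n. \<beta> n p) \<longlongrightarrow> c) H" for p c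
    using tendsto_unique[OF H(1) l that] .
  have l_le: "c \<le> l p" if "\<And>n. c \<le> \<beta> n p" for p c
    using tendsto_lowerbound[OF l _ H(1)] that by auto
  have l_ge: "l p \<le> c" if "\<And>n. \<beta> n p \<le> c" for p c
    using tendsto_upperbound[OF l _ H(1)] that by auto
  define b where "b x y = l (x, y)" for x y
  have bilinear: "bounded_bilinear b"
  proof
    show "b (x + x') y = b x y + b x' y" for x x' y
      unfolding b_def using tendsto_add[OF l[of "(x, y)"] l[of "(x', y)"]]
      by (intro l_eqI) (simp add: \<beta>_def blinfun.add_right inner_add_left int)
    show "b x (y + y') = b x y + b x y'" for x y y'
      unfolding b_def using tendsto_add[OF l[of "(x, y)"] l[of "(x, y')"]]
      by (intro l_eqI) (simp add: \<beta>_def blinfun.add_right inner_add_right int)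
    show "b (c *\<^sub>R x) y = c *\<^sub>R b x y" for c x y
      unfolding b_def using tendsto_mult[OF tendsto_const l[of "(x, y)"], of c]
      by (intro l_eqI) (simp add: \<beta>_def blinfun.scaleR_right)
    show "b x (c *\<^sub>R y) = c *\<^sub>R b x y" for c x y
      unfolding b_def using tendsto_mult[OF tendsto_const l[of "(x, y)"], of c]
      by (intro l_eqI) (simp add: \<beta>_def blinfun.scaleR_right)
    have "norm (b x y) \<le> norm x * norm y * M\<^sup>2" for x y
      unfolding b_def real_norm_def
      using tendsto_upperbound[OF tendsto_rabs[OF l] _ H(1)] \<beta>_le[of _ "(x, y)"]
      by (simp add: mult_ac)
    then show "\<exists>K. \<forall>x y. norm (b x y) \<le> norm x * norm y * K" by blast
  qed
  have sym: "b x y = b y x" for x y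
    unfolding b_def using l[of "(y, x)"] by (intro l_eqI) (simp add: \<beta>_def inner_commute)
  have sesqui: "b (c *\<^sub>C x) y = b x (cnj c *\<^sub>C y)" for c x y
  proof -
    have "\<pi> h (c *\<^sub>C x) = c *\<^sub>C \<pi> h x" for h c x using rep(1)[of h] by (simp add: bounded_ops_def)
    then show ?thesis
      unfolding b_def using l[of "(x, cnj c *\<^sub>C y)"]
      by (intro l_eqI) (simp add: \<beta>_def inner_scaleC_left)
  qed
  have upper: "b x x \<le> C\<^sup>2 * (norm x)\<^sup>2" for x
    unfolding b_def
  proof (rule l_ge)
    fix n
    have "ennreal (\<beta> n (x, x)) \<le> ennreal (C\<^sup>2 * (norm x)\<^sup>2)"
      using avg[of "Suc n" 0 x] by (simp add: \<beta>_diag A_def)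
    then show "\<beta> n (x, x) \<le> C\<^sup>2 * (norm x)\<^sup>2" by (simp add: ennreal_le_iff)
  qed
  have lower: "(norm x)\<^sup>2 \<le> C\<^sup>2 * b x x" for x
  proof -
    have "(norm x)\<^sup>2 / C\<^sup>2 \<le> \<beta> n (x, x)" for n
    proof -
      have [measurable]: "(\<lambda>h. norm (adjoint_op (\<pi> h) x)) \<in> borel_measurable borel"
        by (rule borel_measurable_norm_adjoint[OF rep(4,1)])
      have [measurable]: "(\<lambda>h. norm (adjoint_op (\<pi> (- h)) x)) \<in> borel_measurable m"
        "(\<lambda>h. norm (\<pi> h x)) \<in> borel_measurable m"
      proof -
        show "(\<lambda>h. norm (adjoint_op (\<pi> (- h)) x)) \<in> borel_measurable m"
          by (rule measurable_compose[of uminus m borel])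
            (simp_all add: measurable_cong_sets[OF sets_eq refl]
              borel_measurable_continuous_onI[OF continuous_on_uminus])
        show "(\<lambda>h. norm (\<pi> h x)) \<in> borel_measurable m"
          by (simp add: measurable_cong_sets[OF sets_eq refl])
            (intro borel_measurable_continuous_onI continuous_on_norm rep(4))
      qed
      have A': "A n \<in> sets m" using A(2) by (simp add: sets_eq)
      \<comment> \<open>With weight \<open>t = C\<^sup>2\<close> the adjoint average contributes at
        most \<open>(norm x)\<^sup>2 / 2\<close>, which is absorbed on the left.\<close>
      have t: "0 < C\<^sup>2" using \<open>0 < C\<close> by simp
      have "ennreal ((norm x)\<^sup>2) = average m (A n) (\<lambda>_. (norm x)\<^sup>2)"
        using A A' by (simp add: average_const)
      also have "\<dots> \<le> average m (A n) (\<lambda>h. C\<^sup>2 / 2 * (norm (\<pi> h x))\<^sup>2 +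
          1 / (2 * C\<^sup>2) * (norm (adjoint_op (\<pi> (- h)) x))\<^sup>2)"
        by (intro average_mono norm_power2_le_adjoint[OF \<pi> t])
      also have "\<dots> = average m (A n) (\<lambda>h. C\<^sup>2 / 2 * (norm (\<pi> h x))\<^sup>2) +
          average m (A n) (\<lambda>h. 1 / (2 * C\<^sup>2) * (norm (adjoint_op (\<pi> (- h)) x))\<^sup>2)"
        using A' by (intro average_add) auto
      also have "\<dots> = ennreal (C\<^sup>2 / 2) * average m (A n) (\<lambda>h. (norm (\<pi> h x))\<^sup>2) +
          ennreal (1 / (2 * C\<^sup>2)) * average m (A n) (\<lambda>h. (norm (adjoint_op (\<pi> (- h)) x))\<^sup>2)"
        using A' by (intro arg_cong2[where f = "(+)"] average_cmult) auto
      also have "average m (A n) (\<lambda>h. (norm (adjoint_op (\<pi> (- h)) x))\<^sup>2) =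
          average m (A n) (\<lambda>h. (norm (adjoint_op (\<pi> h) x))\<^sup>2)"
        using A by (intro average_uminus) auto
      also have "ennreal (C\<^sup>2 / 2) * average m (A n) (\<lambda>h. (norm (\<pi> h x))\<^sup>2) +
          ennreal (1 / (2 * C\<^sup>2)) * average m (A n) (\<lambda>h. (norm (adjoint_op (\<pi> h) x))\<^sup>2)
          \<le> ennreal (C\<^sup>2 / 2) * ennreal (\<beta> n (x, x)) +
          ennreal (1 / (2 * C\<^sup>2)) * ennreal (C\<^sup>2 * (norm x)\<^sup>2)"
        unfolding \<beta>_diag using avg_adj[of "Suc n" x]
        by (intro add_mono mult_left_mono) (auto simp: A_def)
      also have "\<dots> = ennreal (C\<^sup>2 / 2 * \<beta> n (x, x) + (norm x)\<^sup>2 / 2)"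
        using \<beta>_nonneg[of n x] \<open>0 < C\<close> by (simp add: ennreal_mult'[symmetric] flip: ennreal_plus)
      finally have "(norm x)\<^sup>2 \<le> C\<^sup>2 / 2 * \<beta> n (x, x) + (norm x)\<^sup>2 / 2"
        using \<beta>_nonneg[of n x] by (simp add: ennreal_le_iff del: ennreal_plus)
      then show ?thesis using \<open>0 < C\<close> by (simp add: field_simps)
    qed
    then have "(norm x)\<^sup>2 / C\<^sup>2 \<le> b x x" unfolding b_def by (rule l_le)
    then show ?thesis using \<open>0 < C\<close> by (simp add: field_simps)
  qed
  have "b (\<pi> g x) (\<pi> g x) = b x x" for g x
  proof -
    \<comment> \<open>One inequality suffices: applied to \<open>- g\<close> and
      \<open>\<pi> g x\<close> it yields the converse.\<close>
    have le: "b (\<pi> g x) (\<pi> g x) \<le> b x x" for g x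
    proof -
      define D where "D = M\<^sup>2 * (norm x * norm x)"
      have "\<beta> n (\<pi> g x, \<pi> g x) \<le> \<beta> n (x, x) + D * r n g" for n
      proof -
        \<comment> \<open>Acting by \<open>\<pi> g\<close> on the vector shifts the variable on the
          right, matching the right translates in the Folner condition.\<close>
        have "ennreal (\<beta> n (\<pi> g x, \<pi> g x)) = average m (A n) (\<lambda>h. (norm (\<pi> (h + g) x))\<^sup>2)"
          by (simp add: \<beta>_diag rep(3))
        also have "\<dots> \<le> ennreal (\<beta> n (x, x)) + ennreal (D * r n g)"
          unfolding \<beta>_diag r_def
        proof (rule average_right_shift_le)
          show "(\<lambda>h. (norm (\<pi> h x))\<^sup>2) \<in> borel_measurable borel"
            using meas[of x x] by (simp add: power2_norm_eq_inner)
          show "(norm (\<pi> h x))\<^sup>2 \<le> D" for h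
            using inner_le[of h x x] by (simp add: D_def power2_norm_eq_inner)
        qed (use A in auto)
        also have "\<dots> = ennreal (\<beta> n (x, x) + D * r n g)"
          using \<beta>_nonneg by (simp add: D_def r_def)
        finally show ?thesis
          using \<beta>_nonneg by (simp add: ennreal_le_iff D_def r_def del: ennreal_plus)
      qed
      moreover have "((\<lambda>n. \<beta> n (x, x) + D * r n g) \<longlongrightarrow> b x x + D * 0) H"
        unfolding b_def using tendsto_mono[OF H(2) r_lim] by (intro tendsto_intros l) auto
      ultimately show ?thesis
        using tendsto_le[OF H(1) _ l] by (simp add: b_def)
    qed
    show ?thesis
      using le[of g x] le[of "- g" "\<pi> g x"] by (simp add: representation_inverse[OF \<pi>])
  qed
  with bilinear sym sesqui lower upper show ?thesis by (rule that)
qed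

end

theorem theorem2p3:
  fixes m :: "'g::{topological_group_add,t2_space} measure"
    and F :: "nat \<Rightarrow> 'g set"
    and \<pi> :: "'g \<Rightarrow> 'h::complex_hilbert_space \<Rightarrow>\<^sub>L 'h"
    and C :: real
  assumes "sigma_compact_space TYPE('g)"
    and "locally_compact_space (euclidean :: 'g topology)"
    and "right_haar_measure m"
    and "unimodular m"
    and "amenable m"
    and "symmetric_folner_sequence m F"
    and "continuous_representation \<pi>"
    and "\<And>g. invertible_op (\<pi> g)"
    and "C \<ge> 1"
    and "\<And>N x g. N \<ge> 1 \<Longrightarrow>
           average m (right_translate (F N) g) (\<lambda>h. (norm (blinfun_apply (\<pi> h) x))\<^sup>2)
             \<le> ennreal (C\<^sup>2 * (norm x)\<^sup>2)"
    and "\<And>N x. N \<ge> 1 \<Longrightarrow>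
           average m (F N) (\<lambda>h. (norm (blinfun_apply (adjoint_op (\<pi> h)) x))\<^sup>2)
             \<le> ennreal (C\<^sup>2 * (norm x)\<^sup>2)"
  shows "unitarizable \<pi> \<and>
         (\<exists>L. invertible_op L \<and> norm (inverse_op L) * norm L \<le> C\<^sup>2 \<and>
              unitary_representation (conjugate_rep L \<pi>))"
proof -
  interpret sigma_compact_unimodular_group m
    using assms(1-4) by unfold_locales
  have "0 < C" using \<open>C \<ge> 1\<close> by simp
  obtain b where "bounded_bilinear b" "\<And>x y. b x y = b y x"
    "\<And>c x y. b (c *\<^sub>C x) y = b x (cnj c *\<^sub>C y)"
    "\<And>x. (norm x)\<^sup>2 \<le> C\<^sup>2 * b x x" "\<And>x. b x x \<le> C\<^sup>2 * (norm x)\<^sup>2"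
    "\<And>g x. b (\<pi> g x) (\<pi> g x) = b x x"
    using invariant_form[OF assms(6,7) \<open>0 < C\<close> assms(10,11)] by blast
  from unitary_conjugate_of_invariant_form[OF assms(7) \<open>0 < C\<close> this]
  obtain L where "invertible_op L" "norm (inverse_op L) * norm L \<le> C\<^sup>2"
    "unitary_representation (conjugate_rep L \<pi>)" by blast
  then show ?thesis unfolding unitarizable_def by blast
qed

end
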